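(* Let $\mathcal X,\mathcal Y$ be real Hilbert spaces, $f:\mathcal X\to(-\infty,+\infty]$ and $g:\mathcal Y\to(-\infty,+\infty]$ proper, convex and lower semicontinuous, and $A:\mathcal X\to\mathcal Y$ bounded linear, with $\mathcal S\ne\emptyset$. Let $\alpha,\beta,\delta:[0,+\infty)\to\mathbb R$ be absolutely continuous with $\beta(t)>0$ for every $t\ge0$. Assume that $\frac\alpha\beta$ and $\frac\delta\beta$ are nonincreasing, and that $$c:=\min\left\{\inf_{t\ge0}\frac{\alpha(t)}{\beta(t)},\ \inf_{t\ge0}\frac{\delta(t)}{\beta(t)}\right\}>\|A\|.$$ Let $(x,y):[0,+\infty)\to\mathcal X\times\mathcal Y$ be a trajectory of $$\left\{\begin{array}{rcl}\alpha(t)\dot x(t)+\beta(t)A^*\dot y(t)+\partial f(x(t))+A^*y(t)&\ni&0\\ \beta(t)A\dot x(t)+\delta(t)\dot y(t)-Ax(t)+\partial g^*(y(t))&\ni&0,\end{array}\right.$$ and let $(\hat x,\hat y)$ be the corresponding ergodic trajectory. Then: (i) The trajectory $(x,y)$ is bounded. As a consequence, the ergodic trajectory $(\hat x,\hat y)$ is also bounded, and both $(x,y)$ and $(\hat x,\hat y)$ admit weak subsequential limit points as $t\to+\infty$. (ii) For every $(u,v)\in\mathcal X\times\mathcal Y$ and every $t>0$, $$\hat\Delta_{u,v}(t)\le\left(\int_0^t\frac{ds}{\beta(s)}\right)^{-1}\mathcal E^S_{u,v}(0).$$ (iii) For every $(\bar x,\bar y)\in\mathcal S$ and every $t\ge0$,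 $$\int_0^t\frac{d_{\bar x,\bar y}(s)}{\beta(s)}\,ds\le\mathcal E^S_{\bar x,\bar y}(0).$$ (iv) If $1/\beta\notin L^1(0,+\infty)$, then every weak subsequential limit point of the ergodic trajectory $(\hat x(t),\hat y(t))$, as $t\to+\infty$, belongs to $\mathcal S$. (v) If $1/\beta\notin L^1(0,+\infty)$ and, moreover, either $\frac\alpha\beta$ and $\frac\delta\beta$ are constant, or $\mathcal S$ is a singleton, then the ergodic trajectory $(\hat x(t),\hat y(t))$ converges weakly, as $t\to+\infty$, to an element of $\mathcal S$.
   Context: $A^*$ is the adjoint of $A$, $\partial$ the convex subdifferential, $g^*$ the Fenchel conjugate of $g$. The underlying problem is $\min_{x\in\mathcal X}f(x)+g(Ax)$. A primal-dual solution is a pair $(\bar x,\bar y)\in\mathcal X\times\mathcal Y$ with $-A^*\bar y\in\partial f(\bar x)$ and $A\bar x\in\partial g^*(\bar y)$; $\mathcal S$ is the set of primal-dual solutions. A trajectory of the system is a pair of functions $x:[0,+\infty)\to\mathcal X$, $y:[0,+\infty)\to\mathcal Y$ that are locally absolutely continuous, such that $f\circ x$ and $g^*\circ y$ are (finite and) locally absolutely continuous on $[0,+\infty)$, and the system holds for almost every $t>0$. The ergodic trajectory is, for $t>0$, $$\hat x(t)=\frac{1}{\int_0^t\frac{ds}{\beta(s)}}\int_0^t\frac{x(s)}{\beta(s)}\,ds,\qquad \hat y(t)=\frac{1}{\int_0^t\frac{ds}{\beta(s)}}\int_0^t\frac{y(s)}{\beta(s)}\,ds.$$ The Lagrangian is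 $\mathcal L(u,v)=f(u)+\langle v,Au\rangle-g^*(v)$, and the ergodic duality gap is $$\hat\Delta_{u,v}(t)=\mathcal L(\hat x(t),v)-\mathcal L(u,\hat y(t)),$$ with value $-\infty$ if $f(u)=+\infty$ or $g^*(v)=+\infty$. The energy is $$\mathcal E^S_{u,v}(t)=\frac{\alpha(t)}{2\beta(t)}\|x(t)-u\|^2+\frac{\delta(t)}{2\beta(t)}\|y(t)-v\|^2+\langle A(x(t)-u),y(t)-v\rangle.$$ With $X(t)=-\alpha(t)\dot x(t)-\beta(t)A^*\dot y(t)-A^*y(t)\in\partial f(x(t))$ and $Y(t)=-\beta(t)A\dot x(t)-\delta(t)\dot y(t)+Ax(t)\in\partial g^*(y(t))$, the Bregman divergence is $$d_{u,v}(t)=[f(u)-f(x(t))-\langle X(t),u-x(t)\rangle]+[g^*(v)-g^*(y(t))-\langle Y(t),v-y(t)\rangle].$$ A weak subsequential limit point of a curve as $t\to+\infty$ is a weak limit of its values along some sequence $t_k\to+\infty$. *)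

theory Defs
  imports "HOL-Analysis.Analysis"
begin

subsection \<open>Convex analysis for extended-real-valued functions\<close>

definition proper_fun :: "('a \<Rightarrow> ereal) \<Rightarrow> bool" where
  "proper_fun f \<longleftrightarrow> (\<forall>x. f x \<noteq> -\<infinity>) \<and> (\<exists>x. f x \<noteq> \<infinity>)"

(* Meant for functions that never take the value -\<infinity>, so that no \<infinity> - \<infinity> occurs on the
   right-hand side; in ereal, 0 * \<infinity> = 0. *)
definition convex_fun :: "('a::real_vector \<Rightarrow> ereal) \<Rightarrow> bool" where
  "convex_fun f \<longleftrightarrow> (\<forall>x y. \<forall>r\<in>{0..1::real}.
     f ((1 - r) *\<^sub>R x + r *\<^sub>R y) \<le> ereal (1 - r) * f x + ereal r * f y)"

definition lsc_fun :: "('a::topological_space \<Rightarrow> ereal) \<Rightarrow> bool" where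
  "lsc_fun f \<longleftrightarrow> (\<forall>x. f x \<le> Liminf (at x) f)"

definition subdifferential :: "('a::real_inner \<Rightarrow> ereal) \<Rightarrow> 'a \<Rightarrow> 'a set" where
  "subdifferential f x =
     {\<xi>. \<bar>f x\<bar> \<noteq> \<infinity> \<and> (\<forall>z. f x + ereal (\<xi> \<bullet> (z - x)) \<le> f z)}"

definition fenchel_conjugate :: "('a::real_inner \<Rightarrow> ereal) \<Rightarrow> 'a \<Rightarrow> ereal" where
  "fenchel_conjugate g v = (SUP z. ereal (v \<bullet> z) - g z)"

(* The library's adjoint is a choice operator; for a bounded linear operator between Hilbert
   spaces it picks the unique operator A* with A x \<bullet> y = x \<bullet> A* y. *)
definition primal_dual_solutions ::
  "('a::real_inner \<Rightarrow> ereal) \<Rightarrow> ('b::real_inner \<Rightarrow> ereal) \<Rightarrow> ('a \<Rightarrow> 'b) \<Rightarrow> ('a \<times> 'b) set" where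
  "primal_dual_solutions f g A =
     {(u, v). - adjoint A v \<in> subdifferential f u \<and>
              A u \<in> subdifferential (fenchel_conjugate g) v}"

definition lagrangian ::
  "('a::real_inner \<Rightarrow> ereal) \<Rightarrow> ('b::real_inner \<Rightarrow> ereal) \<Rightarrow> ('a \<Rightarrow> 'b) \<Rightarrow> 'a \<Rightarrow> 'b \<Rightarrow> ereal" where
  "lagrangian f g A u v = f u + ereal (v \<bullet> A u) - fenchel_conjugate g v"

subsection \<open>Weak convergence\<close>

definition weakly_tendsto :: "('i \<Rightarrow> 'a::real_normed_vector) \<Rightarrow> 'a \<Rightarrow> 'i filter \<Rightarrow> bool" where
  "weakly_tendsto w l F \<longleftrightarrow>
     (\<forall>\<phi> :: 'a \<Rightarrow> real. bounded_linear \<phi> \<longrightarrow> ((\<lambda>i. \<phi> (w i)) \<longlongrightarrow> \<phi> l) F)"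

definition weak_subseq_limit_point :: "(real \<Rightarrow> 'a::real_normed_vector) \<Rightarrow> 'a \<Rightarrow> bool" where
  "weak_subseq_limit_point w l \<longleftrightarrow>
     (\<exists>\<tau> :: nat \<Rightarrow> real. filterlim \<tau> at_top sequentially \<and>
        weakly_tendsto (\<lambda>k. w (\<tau> k)) l sequentially)"

subsection \<open>Absolute continuity\<close>

(* The usual epsilon-delta definition: a division of its own union is a finite family of
   nonoverlapping compact intervals K = {Inf K..Sup K}. *)
definition abs_continuous_on :: "real set \<Rightarrow> (real \<Rightarrow> 'a::real_normed_vector) \<Rightarrow> bool" where
  "abs_continuous_on S h \<longleftrightarrow>
     (\<forall>\<epsilon>>0. \<exists>\<eta>>0. \<forall>D. D division_of \<Union>D \<and> \<Union>D \<subseteq> S \<and> (\<Sum>K\<in>D. Sup K - Inf K) < \<eta> \<longrightarrow>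
        (\<Sum>K\<in>D. norm (h (Sup K) - h (Inf K))) < \<epsilon>)"

definition loc_abs_continuous :: "(real \<Rightarrow> 'a::real_normed_vector) \<Rightarrow> bool" where
  "loc_abs_continuous h \<longleftrightarrow> (\<forall>T>0. abs_continuous_on {0..T} h)"

subsection \<open>The dynamical system\<close>

(* Curves on [0, \<infinity>) are functions on the reals whose values at negative times are irrelevant. *)
definition trajectory ::
  "('a::real_inner \<Rightarrow> ereal) \<Rightarrow> ('b::real_inner \<Rightarrow> ereal) \<Rightarrow> ('a \<Rightarrow> 'b) \<Rightarrow>
   (real \<Rightarrow> real) \<Rightarrow> (real \<Rightarrow> real) \<Rightarrow> (real \<Rightarrow> real) \<Rightarrow> (real \<Rightarrow> 'a) \<Rightarrow> (real \<Rightarrow> 'b) \<Rightarrow> bool" where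
  "trajectory f g A \<alpha> \<beta> \<delta> x y \<longleftrightarrow>
     loc_abs_continuous x \<and> loc_abs_continuous y \<and>
     (\<forall>t\<ge>0. \<bar>f (x t)\<bar> \<noteq> \<infinity>) \<and> loc_abs_continuous (\<lambda>t. real_of_ereal (f (x t))) \<and>
     (\<forall>t\<ge>0. \<bar>fenchel_conjugate g (y t)\<bar> \<noteq> \<infinity>) \<and>
     loc_abs_continuous (\<lambda>t. real_of_ereal (fenchel_conjugate g (y t))) \<and>
     (AE t in lebesgue. t > 0 \<longrightarrow>
        (\<exists>x' y'. (x has_vector_derivative x') (at t) \<and> (y has_vector_derivative y') (at t) \<and>
          (\<exists>\<xi>\<in>subdifferential f (x t).
             \<alpha> t *\<^sub>R x' + \<beta> t *\<^sub>R adjoint A y' + \<xi> + adjoint A (y t) = 0) \<and>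
          (\<exists>\<zeta>\<in>subdifferential (fenchel_conjugate g) (y t).
             \<beta> t *\<^sub>R A x' + \<delta> t *\<^sub>R y' - A (x t) + \<zeta> = 0)))"

(* The integrands below are continuous on the compact interval {0..t}, so the (gauge) integral
   coincides with the Bochner integral; the latter is only available for separable spaces. *)
definition ergodic :: "(real \<Rightarrow> real) \<Rightarrow> (real \<Rightarrow> 'a::real_normed_vector) \<Rightarrow> real \<Rightarrow> 'a" where
  "ergodic \<beta> x t =
     inverse (integral {0..t} (\<lambda>s. 1 / \<beta> s)) *\<^sub>R integral {0..t} (\<lambda>s. (1 / \<beta> s) *\<^sub>R x s)"

definition ergodic_gap ::
  "('a::real_inner \<Rightarrow> ereal) \<Rightarrow> ('b::real_inner \<Rightarrow> ereal) \<Rightarrow> ('a \<Rightarrow> 'b) \<Rightarrow>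
   (real \<Rightarrow> real) \<Rightarrow> (real \<Rightarrow> 'a) \<Rightarrow> (real \<Rightarrow> 'b) \<Rightarrow> 'a \<Rightarrow> 'b \<Rightarrow> real \<Rightarrow> ereal" where
  "ergodic_gap f g A \<beta> x y u v t =
     (if f u = \<infinity> \<or> fenchel_conjugate g v = \<infinity> then -\<infinity>
      else lagrangian f g A (ergodic \<beta> x t) v - lagrangian f g A u (ergodic \<beta> y t))"

definition energy ::
  "('a::real_inner \<Rightarrow> 'b::real_inner) \<Rightarrow> (real \<Rightarrow> real) \<Rightarrow> (real \<Rightarrow> real) \<Rightarrow> (real \<Rightarrow> real) \<Rightarrow>
   (real \<Rightarrow> 'a) \<Rightarrow> (real \<Rightarrow> 'b) \<Rightarrow> 'a \<Rightarrow> 'b \<Rightarrow> real \<Rightarrow> real" where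
  "energy A \<alpha> \<beta> \<delta> x y u v t =
     \<alpha> t / (2 * \<beta> t) * (norm (x t - u))\<^sup>2 + \<delta> t / (2 * \<beta> t) * (norm (y t - v))\<^sup>2
     + A (x t - u) \<bullet> (y t - v)"

definition primal_subgrad ::
  "('a::real_inner \<Rightarrow> 'b::real_inner) \<Rightarrow> (real \<Rightarrow> real) \<Rightarrow> (real \<Rightarrow> real) \<Rightarrow>
   (real \<Rightarrow> 'a) \<Rightarrow> (real \<Rightarrow> 'b) \<Rightarrow> real \<Rightarrow> 'a" where
  "primal_subgrad A \<alpha> \<beta> x y t =
     - (\<alpha> t *\<^sub>R vector_derivative x (at t)) - \<beta> t *\<^sub>R adjoint A (vector_derivative y (at t))
     - adjoint A (y t)"

definition dual_subgrad ::
  "('a::real_inner \<Rightarrow> 'b::real_inner) \<Rightarrow> (real \<Rightarrow> real) \<Rightarrow> (real \<Rightarrow> real) \<Rightarrow>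
   (real \<Rightarrow> 'a) \<Rightarrow> (real \<Rightarrow> 'b) \<Rightarrow> real \<Rightarrow> 'b" where
  "dual_subgrad A \<beta> \<delta> x y t =
     - (\<beta> t *\<^sub>R A (vector_derivative x (at t))) - \<delta> t *\<^sub>R vector_derivative y (at t) + A (x t)"

definition bregman ::
  "('a::real_inner \<Rightarrow> ereal) \<Rightarrow> ('b::real_inner \<Rightarrow> ereal) \<Rightarrow> ('a \<Rightarrow> 'b) \<Rightarrow>
   (real \<Rightarrow> real) \<Rightarrow> (real \<Rightarrow> real) \<Rightarrow> (real \<Rightarrow> real) \<Rightarrow> (real \<Rightarrow> 'a) \<Rightarrow> (real \<Rightarrow> 'b) \<Rightarrow>
   'a \<Rightarrow> 'b \<Rightarrow> real \<Rightarrow> ereal" where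
  "bregman f g A \<alpha> \<beta> \<delta> x y u v t =
     (f u - f (x t) - ereal (primal_subgrad A \<alpha> \<beta> x y t \<bullet> (u - x t)))
     + (fenchel_conjugate g v - fenchel_conjugate g (y t)
        - ereal (dual_subgrad A \<beta> \<delta> x y t \<bullet> (v - y t)))"

end

theory Submission
  imports Defs "HOL-Complex_Analysis.Great_Picard"
begin

text \<open>The proof is a Lyapunov argument. Where \<open>x\<close> and \<open>y\<close> are differentiable, the energy
  \<open>E\<^sub>u\<^sub>,\<^sub>v\<close> has, apart from the nonpositive contribution of the nonincreasing coefficients
  \<open>\<alpha>/\<beta>\<close> and \<open>\<delta>/\<beta>\<close>, the derivative \<open>- (L(x,v) - L(u,y) + d\<^sub>u\<^sub>,\<^sub>v) / \<beta>\<close> with \<open>L\<close> the Lagrangian and \<open>d\<close> the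
  Bregman divergence: the system cancels all the velocity terms
  (\<open>frozen_has_derivative\<close>, \<open>slope_eq\<close>). Since both coefficient quotients exceed \<open>\<parallel>A\<parallel>\<close>
  uniformly, the energy controls the squared distance of \<open>(x,y)\<close> to \<open>(u,v)\<close>.

  At a saddle point the Lagrangian gap and \<open>d\<close> are nonnegative, so the energy decreases and the
  trajectory is bounded; integrating bounds \<open>\<integral> d/\<beta>\<close> by the initial energy. For general
  \<open>(u,v)\<close>, integrating bounds the weighted integral of the gap, and Jensen's inequality passes this
  bound to the ergodic trajectory. If \<open>\<integral> 1/\<beta>\<close> diverges, the ergodic gap is asymptotically
  nonpositive against every \<open>(u,v)\<close>, and weak lower semicontinuity turns every weak limit point into a
  saddle point. When the coefficient quotients are constant, Opial's argument applies: the
  difference of the energies at two solutions is affine in \<open>(x,y)\<close> and converges, hence so do its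
  weighted averages, and comparing their values at two limit points forces these to agree because the
  quadratic form of the energy is positive definite.

  Two analytic devices carry this out. The energy inequality is integrated by a direct Henstock
  argument (\<open>increment_le_integral\<close>), in which absolute continuity absorbs the exceptional null set
  and the nonincreasing coefficients are frozen at the tag. All convexity arguments go through the projection onto closed
  convex sets, applied to epigraphs: separation yields the Riesz representation (hence the adjoint), weak
  compactness without separability, Jensen's inequality and weak lower semicontinuity.\<close>

section \<open>Projection, duality and weak compactness in Hilbert space\<close>

text \<open>By the parallelogram identity, the midpoint of two almost nearest points would be too close to
  \<open>q\<close> if they were far apart; so minimising sequences are Cauchy and completeness replaces the
  compactness available in finite dimension.\<close>
lemma closed_convex_nearest_point:
  fixes C :: "'a::{real_inner, banach} set"
  assumes "closed C" "convex C" "C \<noteq> {}"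
  obtains p where "p \<in> C" "\<And>z. z \<in> C \<Longrightarrow> (q - p) \<bullet> (z - p) \<le> 0"
proof -
  define d where "d = infdist q C"
  have d0: "0 \<le> d" by (simp add: d_def infdist_nonneg)
  have dle: "d \<le> dist q z" if "z \<in> C" for z
    using that by (simp add: d_def infdist_le)
  have "\<exists>z\<in>C. dist q z < d + inverse (real (Suc n))" for n
  proof -
    have "(INF z\<in>C. dist q z) < d + inverse (real (Suc n))"
      using \<open>C \<noteq> {}\<close> by (simp add: d_def infdist_def)
    then show ?thesis
      using \<open>C \<noteq> {}\<close> by (subst (asm) cINF_less_iff) (auto intro!: bdd_belowI2[of _ 0])
  qed
  then obtain w where wC: "\<And>n. w n \<in> C" and wd: "\<And>n. dist q (w n) < d + inverse (real (Suc n))"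
    by metis
  have par: "(norm (a - b))\<^sup>2 \<le> 2 * (norm (q - a))\<^sup>2 + 2 * (norm (q - b))\<^sup>2 - 4 * d\<^sup>2"
    if "a \<in> C" "b \<in> C" for a b
  proof -
    have "(1/2) *\<^sub>R a + (1/2) *\<^sub>R b \<in> C"
      using that \<open>convex C\<close> by (intro convexD) auto
    then have "d\<^sup>2 \<le> (norm (q - ((1/2) *\<^sub>R a + (1/2) *\<^sub>R b)))\<^sup>2"
      using dle d0 by (intro power_mono) (auto simp: dist_norm)
    moreover have "(norm (a - b))\<^sup>2 = 2 * (norm (q - a))\<^sup>2 + 2 * (norm (q - b))\<^sup>2
        - 4 * (norm (q - ((1/2) *\<^sub>R a + (1/2) *\<^sub>R b)))\<^sup>2"
      unfolding power2_norm_eq_inner by (simp add: inner_simps inner_commute algebra_simps)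
    ultimately show ?thesis by linarith
  qed
  have "Cauchy w"
  proof (rule metric_CauchyI)
    fix e :: real assume "0 < e"
    have "(\<lambda>n. 4 * (d + inverse (real (Suc n)))\<^sup>2 - 4 * d\<^sup>2) \<longlonglongrightarrow> 4 * (d + 0)\<^sup>2 - 4 * d\<^sup>2"
      by (intro tendsto_intros LIMSEQ_inverse_real_of_nat)
    then have "\<forall>\<^sub>F n in sequentially. 4 * (d + inverse (real (Suc n)))\<^sup>2 - 4 * d\<^sup>2 < e\<^sup>2"
      using \<open>0 < e\<close> by (intro order_tendstoD(2)) auto
    then obtain N where N: "4 * (d + inverse (real (Suc N)))\<^sup>2 - 4 * d\<^sup>2 < e\<^sup>2"
      by (auto simp: eventually_sequentially)
    have near: "(norm (q - w n))\<^sup>2 \<le> (d + inverse (real (Suc N)))\<^sup>2" if "n \<ge> N" for n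
    proof -
      have "inverse (real (Suc n)) \<le> inverse (real (Suc N))"
        using that by (simp add: field_simps)
      then show ?thesis
        using order_trans[OF less_imp_le[OF wd[of n]] add_left_mono, of "inverse (real (Suc N))"]
        by (intro power_mono) (simp_all add: dist_norm)
    qed
    have "dist (w m) (w n) < e" if "m \<ge> N" "n \<ge> N" for m n
    proof -
      have "(norm (w m - w n))\<^sup>2 < e\<^sup>2"
        using par[OF wC wC, of m n] near[OF that(1)] near[OF that(2)] N by linarith
      then show ?thesis
        using \<open>0 < e\<close> by (simp add: dist_norm power_less_imp_less_base)
    qed
    then show "\<exists>M. \<forall>m\<ge>M. \<forall>n\<ge>M. dist (w m) (w n) < e" by blast
  qed
  then obtain p where p: "w \<longlonglongrightarrow> p"
    using Cauchy_convergent convergent_def by blast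
  have pC: "p \<in> C"
    using closed_sequentially[OF \<open>closed C\<close> wC p] .
  have "dist q p \<le> d"
  proof (rule LIMSEQ_le)
    show "(\<lambda>n. dist q (w n)) \<longlonglongrightarrow> dist q p" by (intro tendsto_intros p)
    show "(\<lambda>n. d + inverse (real (Suc n))) \<longlonglongrightarrow> d"
      using tendsto_add[OF tendsto_const LIMSEQ_inverse_real_of_nat, of d] by simp
  qed (use wd in \<open>auto intro: less_imp_le\<close>)
  then have "\<forall>z\<in>C. dist q p \<le> dist q z" using dle by force
  then show ?thesis
    using that[OF pC] any_closest_point_dot[OF \<open>convex C\<close> \<open>closed C\<close> pC] by blast
qed

lemma closed_convex_separating_vector:
  fixes C :: "'a::{real_inner, banach} set"
  assumes "closed C" "convex C" "q \<notin> C"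
  obtains a b where "\<And>z. z \<in> C \<Longrightarrow> a \<bullet> z \<le> b" "b < a \<bullet> q"
proof (cases "C = {}")
  case True
  then show ?thesis using that[of 0 "-1"] by auto
next
  case False
  obtain p where p: "p \<in> C" "\<And>z. z \<in> C \<Longrightarrow> (q - p) \<bullet> (z - p) \<le> 0"
    using closed_convex_nearest_point[OF assms(1,2) False] by blast
  show ?thesis
  proof (rule that)
    show "(q - p) \<bullet> z \<le> (q - p) \<bullet> p" if "z \<in> C" for z
      using p(2)[OF that] by (simp add: inner_diff_right)
    have "0 < (q - p) \<bullet> (q - p)"
      using p(1) assms(3) by (metis eq_iff_diff_eq_0 inner_gt_zero_iff)
    then show "(q - p) \<bullet> p < (q - p) \<bullet> q" by (simp add: inner_diff_right)
  qed
qed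

text \<open>The representing vector is a multiple of any vector separating the kernel from a point
  outside it.\<close>
lemma riesz_representation:
  fixes \<phi> :: "'a::{real_inner, banach} \<Rightarrow> real"
  assumes "bounded_linear \<phi>"
  obtains a where "\<And>x. \<phi> x = a \<bullet> x"
proof (cases "\<forall>x. \<phi> x = 0")
  case True
  then show ?thesis using that[of 0] by simp
next
  case False
  interpret bounded_linear \<phi> by fact
  obtain q where q: "\<phi> q \<noteq> 0" using False by blast
  define K where "K = {x. \<phi> x = 0}"
  have K: "closed K" "convex K" "q \<notin> K"
    using q closed_Collect_eq[OF continuous_on continuous_on_const, OF continuous_on_id]
    by (auto simp: K_def convex_def add scaleR)
  obtain a b where ab: "\<And>z. z \<in> K \<Longrightarrow> a \<bullet> z \<le> b" "b < a \<bullet> q"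
    using closed_convex_separating_vector[OF K] by blast
  \<comment> \<open>A linear form that is bounded above on a subspace vanishes on it.\<close>
  have aK: "a \<bullet> z = 0" if "z \<in> K" for z
  proof (rule ccontr)
    assume nz: "a \<bullet> z \<noteq> 0"
    have "((b + 1) / (a \<bullet> z)) *\<^sub>R z \<in> K"
      using that by (simp add: K_def scaleR)
    from ab(1)[OF this] show False using nz by simp
  qed
  have "\<phi> x = ((\<phi> q / (a \<bullet> q)) *\<^sub>R a) \<bullet> x" for x
  proof -
    have "x - (\<phi> x / \<phi> q) *\<^sub>R q \<in> K"
      using q by (simp add: K_def diff scaleR)
    from aK[OF this] have "a \<bullet> x = (\<phi> x / \<phi> q) * (a \<bullet> q)"
      by (simp add: inner_diff_right)
    moreover have "a \<bullet> q \<noteq> 0"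
      using ab(1)[of 0] ab(2) by (simp add: K_def zero)
    ultimately show ?thesis using q by (simp add: field_simps)
  qed
  then show ?thesis by (rule that)
qed

lemma adjoint_inner:
  fixes A :: "'a::{real_inner, banach} \<Rightarrow> 'b::real_inner"
  assumes "bounded_linear A"
  shows "A x \<bullet> y = x \<bullet> adjoint A y"
proof -
  have "\<exists>a. \<forall>x. A x \<bullet> y = x \<bullet> a" for y
  proof -
    have "bounded_linear (\<lambda>x. A x \<bullet> y)"
      by (intro bounded_linear_compose[OF bounded_linear_inner_left assms])
    then obtain a where "\<And>x. A x \<bullet> y = a \<bullet> x"
      by (rule riesz_representation) blast
    then show ?thesis by (metis inner_commute)
  qed
  then obtain A' where "\<forall>x y. A x \<bullet> y = x \<bullet> A' y"
    by metis
  then show ?thesis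
    unfolding adjoint_def by (rule someI[of "\<lambda>f'. \<forall>x y. A x \<bullet> y = x \<bullet> f' y", THEN spec, THEN spec])
qed

lemma weakly_tendsto_iff_inner:
  fixes w :: "'i \<Rightarrow> 'a::{real_inner, banach}"
  shows "weakly_tendsto w l F \<longleftrightarrow> (\<forall>a. ((\<lambda>i. a \<bullet> w i) \<longlongrightarrow> a \<bullet> l) F)"
proof
  assume "weakly_tendsto w l F"
  then show "\<forall>a. ((\<lambda>i. a \<bullet> w i) \<longlongrightarrow> a \<bullet> l) F"
    unfolding weakly_tendsto_def using bounded_linear_inner_right by blast
next
  assume R: "\<forall>a. ((\<lambda>i. a \<bullet> w i) \<longlongrightarrow> a \<bullet> l) F"
  show "weakly_tendsto w l F"
    unfolding weakly_tendsto_def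
  proof (intro allI impI)
    fix \<phi> :: "'a \<Rightarrow> real" assume "bounded_linear \<phi>"
    then obtain a where "\<And>x. \<phi> x = a \<bullet> x" by (rule riesz_representation) blast
    then show "((\<lambda>i. \<phi> (w i)) \<longlongrightarrow> \<phi> l) F" using R by simp
  qed
qed

lemma weakly_tendsto_eventually_notin:
  fixes C :: "'a::{real_inner, banach} set"
  assumes "weakly_tendsto w l F" "closed C" "convex C" "l \<notin> C"
  shows "\<forall>\<^sub>F i in F. w i \<notin> C"
proof -
  obtain a b where ab: "\<And>z. z \<in> C \<Longrightarrow> a \<bullet> z \<le> b" "b < a \<bullet> l"
    using closed_convex_separating_vector assms(2-4) by blast
  have "\<forall>\<^sub>F i in F. b < a \<bullet> w i"
    using assms(1) ab(2) by (auto simp: weakly_tendsto_iff_inner intro: order_tendstoD)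
  then show ?thesis
    by eventually_elim (use ab(1) in force)
qed

text \<open>Weak sequential compactness without separability: a diagonal argument makes the inner
  products with the members of the sequence itself converge; by boundedness convergence extends to
  the closed subspace of all good test vectors, and a vector orthogonal to that subspace is
  orthogonal to the whole sequence, hence is a good test vector as well.\<close>

lemma bounded_imp_weakly_convergent_subsequence:
  fixes w :: "nat \<Rightarrow> 'a::{real_inner, banach}"
  assumes "bounded (range w)"
  obtains l r where "strict_mono (r :: nat \<Rightarrow> nat)" "weakly_tendsto (w \<circ> r) l sequentially"
proof -
  obtain R where R: "\<And>n. norm (w n) \<le> R" "0 < R"
    using assms by (auto simp: bounded_pos)
  have "norm (w m \<bullet> w n) \<le> R * R" for m n
    using order_trans[OF Cauchy_Schwarz_ineq2 mult_mono[OF R(1)[of m] R(1)[of n]]] R(2) by simp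
  then obtain r where r: "strict_mono (r :: nat \<Rightarrow> nat)"
      "\<And>m. \<exists>l. (\<lambda>n. w m \<bullet> w (r n)) \<longlonglongrightarrow> l"
    using function_convergent_subsequence[of "UNIV :: nat set" "\<lambda>n m. w m \<bullet> w n" "R * R"]
    by (metis UNIV_I uncountable_def countableI_type)
  define M where "M = {a. convergent (\<lambda>n. a \<bullet> w (r n))}"
  have wM: "w m \<in> M" for m using r(2) by (auto simp: M_def convergent_def)
  have M0: "0 \<in> M" by (simp add: M_def convergent_const)
  have Madd: "a + b \<in> M" if "a \<in> M" "b \<in> M" for a b
    using that by (simp add: M_def inner_add_left convergent_add)
  have Mscale: "k *\<^sub>R a \<in> M" if "a \<in> M" for a k
    using that by (auto simp: M_def convergent_def intro: tendsto_mult_left)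
  have Mclosed: "closed M"
    unfolding closed_sequential_limits
  proof (intro allI impI)
    fix a l assume al: "(\<forall>n. a n \<in> M) \<and> a \<longlonglongrightarrow> l"
    have "Cauchy (\<lambda>n. l \<bullet> w (r n))"
    proof (rule metric_CauchyI)
      fix e :: real assume "0 < e"
      then obtain k where k: "dist (a k) l < e / (3 * R)"
        using al R(2) metric_LIMSEQ_D[of a l "e / (3 * R)"] by auto
      have diff: "\<bar>l \<bullet> w n - a k \<bullet> w n\<bar> \<le> e / 3" for n
      proof -
        have "\<bar>l \<bullet> w n - a k \<bullet> w n\<bar> \<le> norm (l - a k) * norm (w n)"
          by (metis Cauchy_Schwarz_ineq2 inner_diff_left)
        also have "\<dots> \<le> e / (3 * R) * R"
          using k R \<open>0 < e\<close> by (intro mult_mono) (auto simp: dist_norm norm_minus_commute)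
        finally show ?thesis using R(2) by simp
      qed
      have "Cauchy (\<lambda>n. a k \<bullet> w (r n))"
        using al by (simp add: M_def convergent_Cauchy)
      then obtain N where N: "\<And>m n. m \<ge> N \<Longrightarrow> n \<ge> N \<Longrightarrow> dist (a k \<bullet> w (r m)) (a k \<bullet> w (r n)) < e / 3"
        using \<open>0 < e\<close> metric_CauchyD[of "\<lambda>n. a k \<bullet> w (r n)" "e / 3"] by auto
      have "dist (l \<bullet> w (r m)) (l \<bullet> w (r n)) < e" if "m \<ge> N" "n \<ge> N" for m n
        using N[OF that] diff[of "r m"] diff[of "r n"] unfolding dist_real_def by linarith
      then show "\<exists>N. \<forall>m\<ge>N. \<forall>n\<ge>N. dist (l \<bullet> w (r m)) (l \<bullet> w (r n)) < e" by blast
    qed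
    then show "l \<in> M" by (simp add: M_def Cauchy_convergent)
  qed
  have Mconvex: "convex M"
    by (auto simp: convex_def intro: Madd Mscale)
  have M_UNIV: "a \<in> M" for a
  proof (rule ccontr)
    assume "a \<notin> M"
    then obtain c b where cb: "\<And>z. z \<in> M \<Longrightarrow> c \<bullet> z \<le> b" "b < c \<bullet> a"
      using closed_convex_separating_vector Mclosed Mconvex by blast
    have cM: "c \<bullet> z = 0" if "z \<in> M" for z
    proof (rule ccontr)
      assume "c \<bullet> z \<noteq> 0"
      then show False using cb(1)[OF Mscale[OF that, of "(b + 1) / (c \<bullet> z)"]] by simp
    qed
    have "c \<in> M" using cM[OF wM] by (simp add: M_def convergent_const)
    then have "c = 0" using cM by force
    then show False using cb M0 by force
  qed
  define \<phi> where "\<phi> a = lim (\<lambda>n. a \<bullet> w (r n))" for a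
  have \<phi>: "(\<lambda>n. a \<bullet> w (r n)) \<longlonglongrightarrow> \<phi> a" for a
    using M_UNIV[of a] by (simp add: M_def \<phi>_def convergent_LIMSEQ_iff)
  have "bounded_linear \<phi>"
  proof (rule bounded_linear_intro)
    show "\<phi> (a + b) = \<phi> a + \<phi> b" for a b
      using LIMSEQ_unique[OF \<phi>[of "a + b"]] tendsto_add[OF \<phi>[of a] \<phi>[of b]]
      by (simp add: inner_add_left)
    show "\<phi> (k *\<^sub>R a) = k *\<^sub>R \<phi> a" for a k
      using LIMSEQ_unique[OF \<phi>[of "k *\<^sub>R a"]] tendsto_mult_left[OF \<phi>[of a], of k] by simp
    show "norm (\<phi> a) \<le> norm a * R" for a
    proof (rule LIMSEQ_le_const2[OF tendsto_norm[OF \<phi>]], intro exI allI impI)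
      show "norm (a \<bullet> w (r n)) \<le> norm a * R" for n
        using Cauchy_Schwarz_ineq2[of a "w (r n)"] mult_left_mono[OF R(1), of "norm a" "r n"] by simp
    qed
  qed
  then obtain l where "\<And>a. \<phi> a = l \<bullet> a" by (rule riesz_representation) blast
  then have "weakly_tendsto (w \<circ> r) l sequentially"
    using \<phi> by (simp add: weakly_tendsto_iff_inner inner_commute o_def)
  then show ?thesis using that r(1) by blast
qed

lemma bounded_curve_weak_limit_point_along:
  fixes w :: "real \<Rightarrow> 'a::{real_inner, banach}"
  assumes "bounded (w ` {0<..})" "filterlim \<tau> at_top (sequentially)"
  obtains r p where "strict_mono (r :: nat \<Rightarrow> nat)"
    "weakly_tendsto (\<lambda>k. w (\<tau> (r k))) p sequentially"
    "weak_subseq_limit_point w p"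
proof -
  have "\<forall>\<^sub>F k in sequentially. 0 < \<tau> k"
    using assms(2) by (simp add: filterlim_at_top_dense)
  then obtain N where N: "\<And>k. N \<le> k \<Longrightarrow> 0 < \<tau> k"
    by (auto simp: eventually_sequentially)
  have "bounded (range (\<lambda>k. w (\<tau> (k + N))))"
    by (rule bounded_subset[OF assms(1)]) (use N in auto)
  then obtain p r where rp: "strict_mono (r :: nat \<Rightarrow> nat)"
      "weakly_tendsto ((\<lambda>k. w (\<tau> (k + N))) \<circ> r) p sequentially"
    by (rule bounded_imp_weakly_convergent_subsequence)
  define r' where "r' k = r k + N" for k
  have r': "strict_mono r'" using rp(1) by (simp add: r'_def strict_mono_def)
  have w: "weakly_tendsto (\<lambda>k. w (\<tau> (r' k))) p sequentially"
    using rp(2) by (simp add: r'_def o_def)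
  have "filterlim (\<lambda>k. \<tau> (r' k)) at_top sequentially"
    using filterlim_compose[OF assms(2) filterlim_subseq[OF r']] .
  then have "weak_subseq_limit_point w p"
    unfolding weak_subseq_limit_point_def using w by blast
  then show ?thesis using that r' w by blast
qed

lemma bounded_curve_has_weak_limit_point:
  fixes w :: "real \<Rightarrow> 'c::{real_inner, banach}"
  assumes "bounded (w ` {0<..})"
  shows "\<exists>p. weak_subseq_limit_point w p"
  using bounded_curve_weak_limit_point_along[OF assms filterlim_real_sequentially] by metis

text \<open>By weak compactness, a curve that stayed away from \<open>p\<close> in some direction along a sequence
  would have a second limit point.\<close>
lemma bounded_curve_weakly_tendsto:
  fixes w :: "real \<Rightarrow> 'a::{real_inner, banach}"
  assumes bdd: "bounded (w ` {0<..})"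
    and unique: "\<And>q. weak_subseq_limit_point w q \<Longrightarrow> q = p"
  shows "weakly_tendsto w p at_top"
  unfolding weakly_tendsto_iff_inner
proof (intro allI)
  fix a
  show "((\<lambda>t. a \<bullet> w t) \<longlongrightarrow> a \<bullet> p) at_top"
  proof (rule ccontr)
    assume "\<not> ?thesis"
    then obtain e where e: "0 < e" "\<not> (\<forall>\<^sub>F t in at_top. dist (a \<bullet> w t) (a \<bullet> p) < e)"
      unfolding tendsto_iff by blast
    then have "\<exists>t\<ge>real n. e \<le> dist (a \<bullet> w t) (a \<bullet> p)" for n
      unfolding eventually_at_top_linorder not_less[symmetric] by blast
    then obtain \<tau> where \<tau>: "\<And>n. real n \<le> \<tau> n" "\<And>n. e \<le> dist (a \<bullet> w (\<tau> n)) (a \<bullet> p)"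
      by metis
    have "filterlim \<tau> at_top sequentially"
      by (rule filterlim_at_top_mono[OF filterlim_real_sequentially]) (simp add: \<tau>)
    then obtain r q where rq: "strict_mono (r :: nat \<Rightarrow> nat)"
        "weakly_tendsto (\<lambda>k. w (\<tau> (r k))) q sequentially" "weak_subseq_limit_point w q"
      using bounded_curve_weak_limit_point_along[OF bdd] by blast
    have "(\<lambda>k. a \<bullet> w (\<tau> (r k))) \<longlonglongrightarrow> a \<bullet> p"
      using rq(2) unique[OF rq(3)] by (simp add: weakly_tendsto_iff_inner)
    then have "\<forall>\<^sub>F k in sequentially. dist (a \<bullet> w (\<tau> (r k))) (a \<bullet> p) < e"
      using e(1) by (simp add: tendsto_iff)
    then show False using \<tau>(2) by (auto simp: eventually_sequentially not_less[symmetric])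
  qed
qed

section \<open>Absolute continuity and integral bounds\<close>

lemma abs_continuous_onE:
  assumes "abs_continuous_on S h" "0 < \<epsilon>"
  obtains \<eta> where "0 < \<eta>"
    "\<And>D. D division_of \<Union>D \<Longrightarrow> \<Union>D \<subseteq> S \<Longrightarrow> (\<Sum>K\<in>D. Sup K - Inf K) < \<eta> \<Longrightarrow>
        (\<Sum>K\<in>D. norm (h (Sup K) - h (Inf K))) < \<epsilon>"
proof -
  have "\<exists>\<eta>>0. \<forall>D. D division_of \<Union>D \<and> \<Union>D \<subseteq> S \<and> (\<Sum>K\<in>D. Sup K - Inf K) < \<eta> \<longrightarrow>
        (\<Sum>K\<in>D. norm (h (Sup K) - h (Inf K))) < \<epsilon>"
    using assms by (simp add: abs_continuous_on_def)
  then show ?thesis using that by auto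
qed

lemma abs_continuous_on_subset:
  assumes "abs_continuous_on S h" "T \<subseteq> S"
  shows "abs_continuous_on T h"
  unfolding abs_continuous_on_def
proof (intro allI impI)
  fix \<epsilon> :: real assume "0 < \<epsilon>"
  then obtain \<eta> where \<eta>: "0 < \<eta>" "\<And>D. D division_of \<Union>D \<Longrightarrow> \<Union>D \<subseteq> S \<Longrightarrow> (\<Sum>K\<in>D. Sup K - Inf K) < \<eta> \<Longrightarrow>
        (\<Sum>K\<in>D. norm (h (Sup K) - h (Inf K))) < \<epsilon>"
    using abs_continuous_onE[OF assms(1)] by blast
  then show "\<exists>\<eta>>0. \<forall>D. D division_of \<Union>D \<and> \<Union>D \<subseteq> T \<and> (\<Sum>K\<in>D. Sup K - Inf K) < \<eta> \<longrightarrow>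
        (\<Sum>K\<in>D. norm (h (Sup K) - h (Inf K))) < \<epsilon>"
    using assms(2) by (intro exI[of _ \<eta>]) auto
qed

lemma abs_continuous_onD_interval:
  assumes "abs_continuous_on S h" "0 < \<epsilon>"
  obtains \<eta> where "0 < \<eta>"
    "\<And>r s. {r..s} \<subseteq> S \<Longrightarrow> r \<le> s \<Longrightarrow> s - r < \<eta> \<Longrightarrow> norm (h s - h r) < \<epsilon>"
proof -
  obtain \<eta> where \<eta>: "0 < \<eta>" "\<And>D. D division_of \<Union>D \<Longrightarrow> \<Union>D \<subseteq> S \<Longrightarrow> (\<Sum>K\<in>D. Sup K - Inf K) < \<eta> \<Longrightarrow>
        (\<Sum>K\<in>D. norm (h (Sup K) - h (Inf K))) < \<epsilon>"
    using abs_continuous_onE[OF assms] by blast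
  have "norm (h s - h r) < \<epsilon>" if "{r..s} \<subseteq> S" "r \<le> s" "s - r < \<eta>" for r s
    using \<eta>(2)[of "{{r..s}}"] that division_of_self[of r s] by simp
  then show ?thesis using that \<eta>(1) by blast
qed

lemma loc_abs_continuous_imp_continuous_on:
  assumes "loc_abs_continuous h"
  shows "continuous_on {0..} h"
  unfolding continuous_on_iff
proof (intro ballI allI impI)
  fix t :: real and e :: real assume "t \<in> {0..}" "0 < e"
  then have "abs_continuous_on {0..t + 1} h"
    using assms by (simp add: loc_abs_continuous_def)
  then obtain \<eta> where \<eta>: "0 < \<eta>"
      "\<And>r s. {r..s} \<subseteq> {0..t + 1} \<Longrightarrow> r \<le> s \<Longrightarrow> s - r < \<eta> \<Longrightarrow> norm (h s - h r) < e"
    using abs_continuous_onD_interval \<open>0 < e\<close> by blast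
  have "dist (h s) (h t) < e" if "s \<in> {0..}" "dist s t < min \<eta> 1" for s
    using \<eta>(2)[of t s] \<eta>(2)[of s t] that \<open>t \<in> {0..}\<close>
    by (cases "s \<le> t") (auto simp: dist_norm norm_minus_commute)
  then show "\<exists>d>0. \<forall>s\<in>{0..}. dist s t < d \<longrightarrow> dist (h s) (h t) < e"
    using \<eta>(1) by (intro exI[of _ "min \<eta> 1"]) auto
qed

lemma abs_continuous_on_Pair:
  assumes "abs_continuous_on S x" "abs_continuous_on S y"
  shows "abs_continuous_on S (\<lambda>t. (x t, y t))"
  unfolding abs_continuous_on_def
proof (intro allI impI)
  fix \<epsilon> :: real assume "0 < \<epsilon>"
  then have "0 < \<epsilon> / 2" by simp
  obtain \<eta>1 where \<eta>1: "0 < \<eta>1"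
    and 1: "\<And>D. D division_of \<Union>D \<Longrightarrow> \<Union>D \<subseteq> S \<Longrightarrow> (\<Sum>K\<in>D. Sup K - Inf K) < \<eta>1 \<Longrightarrow>
        (\<Sum>K\<in>D. norm (x (Sup K) - x (Inf K))) < \<epsilon> / 2"
    using abs_continuous_onE[OF assms(1) \<open>0 < \<epsilon> / 2\<close>] by blast
  obtain \<eta>2 where \<eta>2: "0 < \<eta>2"
    and 2: "\<And>D. D division_of \<Union>D \<Longrightarrow> \<Union>D \<subseteq> S \<Longrightarrow> (\<Sum>K\<in>D. Sup K - Inf K) < \<eta>2 \<Longrightarrow>
        (\<Sum>K\<in>D. norm (y (Sup K) - y (Inf K))) < \<epsilon> / 2"
    using abs_continuous_onE[OF assms(2) \<open>0 < \<epsilon> / 2\<close>] by blast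
  have "(\<Sum>K\<in>D. norm ((x (Sup K), y (Sup K)) - (x (Inf K), y (Inf K)))) < \<epsilon>"
    if "D division_of \<Union>D" "\<Union>D \<subseteq> S" "(\<Sum>K\<in>D. Sup K - Inf K) < min \<eta>1 \<eta>2" for D
  proof -
    have "(\<Sum>K\<in>D. norm ((x (Sup K), y (Sup K)) - (x (Inf K), y (Inf K))))
        \<le> (\<Sum>K\<in>D. norm (x (Sup K) - x (Inf K))) + (\<Sum>K\<in>D. norm (y (Sup K) - y (Inf K)))"
      unfolding sum.distrib[symmetric] by (intro sum_mono) (simp add: norm_Pair_le)
    then show ?thesis using 1[OF that(1,2)] 2[OF that(1,2)] that(3) by simp
  qed
  then show "\<exists>\<eta>>0. \<forall>D. D division_of \<Union>D \<and> \<Union>D \<subseteq> S \<and> (\<Sum>K\<in>D. Sup K - Inf K) < \<eta> \<longrightarrow>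
       (\<Sum>K\<in>D. norm ((x (Sup K), y (Sup K)) - (x (Inf K), y (Inf K)))) < \<epsilon>"
    using \<eta>1 \<eta>2 by (intro exI[of _ "min \<eta>1 \<eta>2"]) auto
qed

lemma has_real_derivative_straddle:
  fixes G :: "real \<Rightarrow> real"
  assumes "(G has_real_derivative D) (at t)" "0 < e"
  obtains d where "0 < d"
    "\<And>r s. r \<le> t \<Longrightarrow> t \<le> s \<Longrightarrow> dist r t < d \<Longrightarrow> dist s t < d \<Longrightarrow> G s - G r \<le> (D + e) * (s - r)"
proof -
  obtain d where d: "0 < d" "\<And>y. norm (y - t) < d \<Longrightarrow> norm (G y - G t - D * (y - t)) \<le> e * norm (y - t)"
    using assms unfolding has_field_derivative_def has_derivative_at_alt by blast
  have "G s - G r \<le> (D + e) * (s - r)" if "r \<le> t" "t \<le> s" "dist r t < d" "dist s t < d" for r s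
    using d(2)[of r] d(2)[of s] that by (simp add: dist_norm abs_le_iff algebra_simps)
  then show ?thesis using that d(1) by blast
qed

text \<open>Relates the total length in the definition of absolute continuity to Lebesgue measure, in which
  the exceptional set is small.\<close>
lemma sum_length_division_le_measure:
  assumes D: "D division_of \<Union>D" and "\<Union>D \<subseteq> U" "U \<in> lmeasurable"
  shows "(\<Sum>K\<in>D. Sup K - Inf (K::real set)) \<le> measure lebesgue U"
proof -
  have len: "((\<lambda>_. 1::real) has_integral (Sup K - Inf K)) K" if KD: "K \<in> D" for K
  proof -
    obtain u v where K: "K = {u..v}" "u \<le> v"
      using division_ofD(3)[OF D KD] division_ofD(4)[OF D KD] by fastforce
    then show ?thesis using has_integral_const_real[of "1::real" u v] by simp
  qed
  have "((\<lambda>_. 1::real) has_integral (\<Sum>K\<in>D. Sup K - Inf K)) (\<Union>D)"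
    using has_integral_combine_division[OF D len] .
  then have "(\<Union>D) \<in> lmeasurable" "measure lebesgue (\<Union>D) = (\<Sum>K\<in>D. Sup K - Inf K)"
    by (auto simp: lmeasurable_iff_has_integral[THEN iffD2] lmeasurable_iff_integrable_on
        lmeasure_integral has_integral_iff)
  then show ?thesis
    using measure_mono_fmeasurable[of "\<Union>D" U lebesgue] assms by (simp add: fmeasurableD)
qed

text \<open>A one-sided fundamental theorem of calculus. At a tag outside \<open>N\<close> the increment of \<open>h\<close>
  is compared with that of a differentiable majorant \<open>G\<close>, which may depend on the tag; the intervals
  tagged in \<open>N\<close> are forced into an open set of small measure, where the absolutely continuous curve
  \<open>z\<close> controls their total contribution. Only upper bounds on increments are involved, so that \<open>h\<close>
  may contain nonincreasing factors.\<close>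
lemma increment_le_integral:
  fixes h \<psi> :: "real \<Rightarrow> real" and z :: "real \<Rightarrow> 'n::real_normed_vector"
  assumes ab: "a \<le> b"
    and z: "abs_continuous_on {a..b} z" and C: "0 \<le> C"
    and hz: "\<And>r s. a \<le> r \<Longrightarrow> r \<le> s \<Longrightarrow> s \<le> b \<Longrightarrow> h s - h r \<le> C * norm (z s - z r)"
    and \<psi>: "\<psi> integrable_on {a..b}" and N: "negligible N"
    and maj: "\<And>t. t \<in> {a..b} - N \<Longrightarrow> \<exists>G D. (G has_real_derivative D) (at t) \<and> D \<le> \<psi> t \<and>
        (\<forall>r s. a \<le> r \<longrightarrow> r \<le> t \<longrightarrow> t \<le> s \<longrightarrow> s \<le> b \<longrightarrow> h s - h r \<le> G s - G r)"
  shows "h b - h a \<le> integral {a..b} \<psi>"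
proof (rule field_le_epsilon)
  fix e0 :: real assume "0 < e0"
  define e where "e = e0 / (1 + (b - a) + C)"
  have den: "0 < 1 + (b - a) + C" using ab C by simp
  have "0 < e" using \<open>0 < e0\<close> den by (simp add: e_def)
  define \<psi>0 where "\<psi>0 t = (if t \<in> N then 0 else \<psi> t)" for t
  have int0: "(\<psi>0 has_integral integral {a..b} \<psi>) (cbox a b)"
    using has_integral_spike[OF N, of "{a..b}" \<psi>0 \<psi>] integrable_integral[OF \<psi>]
    by (simp add: \<psi>0_def)
  obtain \<gamma> where \<gamma>: "gauge \<gamma>" "\<And>p. p tagged_division_of cbox a b \<Longrightarrow> \<gamma> fine p \<Longrightarrow>
      norm ((\<Sum>(t, K)\<in>p. measure lborel K *\<^sub>R \<psi>0 t) - integral {a..b} \<psi>) < e"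
    by (rule has_integralD[OF int0 \<open>0 < e\<close>]) (rule that)
  obtain \<eta> where \<eta>: "0 < \<eta>" "\<And>D. D division_of \<Union>D \<Longrightarrow> \<Union>D \<subseteq> {a..b} \<Longrightarrow> (\<Sum>K\<in>D. Sup K - Inf K) < \<eta> \<Longrightarrow>
      (\<Sum>K\<in>D. norm (z (Sup K) - z (Inf K))) < e"
    using abs_continuous_onE[OF z \<open>0 < e\<close>] by blast
  obtain U where U: "open U" "N \<subseteq> U" "U \<in> lmeasurable" "measure lebesgue U < \<eta>"
  proof -
    obtain T where T: "open T" "N \<subseteq> T" "T - N \<in> lmeasurable" "emeasure lebesgue (T - N) < ennreal \<eta>"
      using sets_lebesgue_outer_open[OF fmeasurableD[OF negligible_imp_measurable[OF N]] \<eta>(1)] by blast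
    have "(T - N) \<union> N \<in> lmeasurable"
      by (intro fmeasurable.Un T(3) negligible_imp_measurable N)
    then have TL: "T \<in> lmeasurable" using T(2) by (simp add: Un_absorb2)
    have "measure lebesgue (T - N) = measure lebesgue T"
      using N TL by (simp add: measure_Diff_null_set negligible_iff_null_sets fmeasurableD)
    moreover have "measure lebesgue (T - N) < \<eta>"
      using T(3,4) \<eta>(1) by (simp add: emeasure_eq_measure2 ennreal_less_iff)
    ultimately show ?thesis using that T(1,2) TL by simp
  qed
  have "\<exists>d>0. (t \<in> N \<longrightarrow> ball t d \<subseteq> U) \<and> (t \<in> {a..b} - N \<longrightarrow> (\<forall>r s. a \<le> r \<longrightarrow> r \<le> t \<longrightarrow> t \<le> s \<longrightarrow> s \<le> b \<longrightarrow>
      dist r t < d \<longrightarrow> dist s t < d \<longrightarrow> h s - h r \<le> (\<psi> t + e) * (s - r)))"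
    (is "\<exists>d>0. ?P t d") for t
  proof (cases "t \<in> {a..b} - N")
    case True
    then obtain G D where G: "(G has_real_derivative D) (at t)" "D \<le> \<psi> t"
        "\<And>r s. a \<le> r \<Longrightarrow> r \<le> t \<Longrightarrow> t \<le> s \<Longrightarrow> s \<le> b \<Longrightarrow> h s - h r \<le> G s - G r"
      using maj by metis
    obtain d where d: "0 < d"
        "\<And>r s. r \<le> t \<Longrightarrow> t \<le> s \<Longrightarrow> dist r t < d \<Longrightarrow> dist s t < d \<Longrightarrow> G s - G r \<le> (D + e) * (s - r)"
      using has_real_derivative_straddle[OF G(1) \<open>0 < e\<close>] by blast
    have "h s - h r \<le> (\<psi> t + e) * (s - r)"
      if "a \<le> r" "r \<le> t" "t \<le> s" "s \<le> b" "dist r t < d" "dist s t < d" for r s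
    proof -
      have "(D + e) * (s - r) \<le> (\<psi> t + e) * (s - r)"
        using G(2) that by (intro mult_right_mono) auto
      then show ?thesis using G(3)[OF that(1-4)] d(2)[OF that(2,3,5,6)] by linarith
    qed
    then show ?thesis using True d(1) by blast
  next
    case False
    show ?thesis
    proof (cases "t \<in> N")
      case True
      then obtain d where "0 < d" "ball t d \<subseteq> U"
        using U(1,2) open_contains_ball by blast
      then show ?thesis using True by blast
    qed (use False in \<open>auto intro: exI[of _ 1]\<close>)
  qed
  then have "\<exists>d. \<forall>t. 0 < d t \<and> ?P t (d t)" by (intro choice) blast
  then obtain d where d: "\<And>t. 0 < d t" "\<And>t. t \<in> N \<Longrightarrow> ball t (d t) \<subseteq> U"
    "\<And>t r s. t \<in> {a..b} - N \<Longrightarrow> a \<le> r \<Longrightarrow> r \<le> t \<Longrightarrow> t \<le> s \<Longrightarrow> s \<le> b \<Longrightarrow>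
      dist r t < d t \<Longrightarrow> dist s t < d t \<Longrightarrow> h s - h r \<le> (\<psi> t + e) * (s - r)"
    by blast
  have "gauge (\<lambda>t. \<gamma> t \<inter> ball t (d t))"
    using \<gamma>(1) d(1) by (intro gauge_Int gauge_ball_dependent) auto
  then obtain p where p: "p tagged_division_of {a..b}" "(\<lambda>t. \<gamma> t \<inter> ball t (d t)) fine p"
    using fine_division_exists_real by blast
  have fine: "\<gamma> fine p" "(\<lambda>t. ball t (d t)) fine p"
    using p(2) by (auto simp: fine_Int)
  define q where "q = {(t, K) \<in> p. t \<in> N}"
  have qp: "q \<subseteq> p" by (auto simp: q_def)
  have finp: "finite p" using p(1) by blast
  \<comment> \<open>The value on the empty set is fixed because \<open>Sup {}\<close> and \<open>Inf {}\<close> need not agree.\<close>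
  define \<nu> where "\<nu> K = (if K = {} then 0 else norm (z (Sup K) - z (Inf K)))" for K
  have q: "q tagged_partial_division_of {a..b}"
    using tagged_partial_division_subset[OF _ qp] p(1) unfolding tagged_division_of_def by blast
  have D: "snd ` q division_of \<Union>(snd ` q)"
    using partial_division_of_tagged_division[OF q] .
  have "(\<Sum>(t, K)\<in>q. \<nu> K) = (\<Sum>K\<in>snd ` q. \<nu> K)"
    by (rule sum.over_tagged_division_lemma[OF tagged_partial_division_of_Union_self[OF q]])
       (auto simp: \<nu>_def not_less)
  also have "\<dots> = (\<Sum>K\<in>snd ` q. norm (z (Sup K) - z (Inf K)))"
    using division_ofD(3)[OF D] by (intro sum.cong) (auto simp: \<nu>_def)
  also have "\<dots> < e"
  proof (rule \<eta>(2)[OF D])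
    show "\<Union>(snd ` q) \<subseteq> {a..b}"
      using tagged_partial_division_ofD(3)[OF q] by fastforce
    have "\<Union>(snd ` q) \<subseteq> U"
    proof -
      have "K \<subseteq> U" if "(t, K) \<in> q" for t K
        using that fineD[OF fine(2), of t K] d(2)[of t] by (auto simp: q_def)
      then show ?thesis by fastforce
    qed
    then show "(\<Sum>K\<in>snd ` q. Sup K - Inf K) < \<eta>"
      using sum_length_division_le_measure[OF D _ U(3)] U(4) by linarith
  qed
  finally have q_small: "(\<Sum>(t, K)\<in>q. \<nu> K) < e" .
  have term_le: "h (Sup K) - h (Inf K) \<le> measure lborel K *\<^sub>R \<psi>0 t + e * measure lborel K + (if t \<in> N then C * \<nu> K else 0)"
    if tK: "(t, K) \<in> p" for t K
  proof -
    obtain u v where uv: "K = {u..v}" using tagged_division_ofD(4)[OF p(1) tK] by auto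
    have t: "u \<le> t" "t \<le> v" "a \<le> u" "v \<le> b" "t \<in> {a..b}"
      using tagged_division_ofD(2,3)[OF p(1) tK] uv by auto
    have "u \<in> K" "v \<in> K" using t(1,2) by (simp_all add: uv)
    then have "u \<in> ball t (d t)" "v \<in> ball t (d t)"
      using fineD[OF fine(2) tK] by blast+
    then have uvd: "dist u t < d t" "dist v t < d t" by (simp_all add: dist_commute)
    show ?thesis
    proof (cases "t \<in> N")
      case True
      have "h v - h u \<le> C * norm (z v - z u)" using hz[of u v] t by auto
      moreover have "0 \<le> e * (v - u)" using \<open>0 < e\<close> t by simp
      ultimately show ?thesis using True t by (simp add: uv \<psi>0_def \<nu>_def)
    next
      case False
      have "h v - h u \<le> (\<psi> t + e) * (v - u)" using d(3)[of t u v] False t uvd by auto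
      then show ?thesis using False t by (simp add: uv \<psi>0_def algebra_simps)
    qed
  qed
  have "h b - h a = (\<Sum>(t, K)\<in>p. h (Sup K) - h (Inf K))"
    using additive_tagged_division_1[OF ab p(1), of h] by simp
  also have "\<dots> \<le> (\<Sum>(t, K)\<in>p. measure lborel K *\<^sub>R \<psi>0 t + e * measure lborel K + (if t \<in> N then C * \<nu> K else 0))"
    by (intro sum_mono) (use term_le in auto)
  also have "\<dots> = (\<Sum>(t, K)\<in>p. measure lborel K *\<^sub>R \<psi>0 t) + e * (\<Sum>(t, K)\<in>p. measure lborel K)
      + (\<Sum>(t, K)\<in>p. if t \<in> N then C * \<nu> K else 0)"
    by (simp add: case_prod_unfold sum.distrib sum_distrib_left)
  also have "(\<Sum>(t, K)\<in>p. measure lborel K) = b - a"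
    using additive_content_tagged_division[of p a b] p(1) ab by simp
  also have "(\<Sum>(t, K)\<in>p. if t \<in> N then C * \<nu> K else 0) = C * (\<Sum>(t, K)\<in>q. \<nu> K)"
    unfolding q_def sum_distrib_left using finp
    by (simp add: case_prod_unfold sum.inter_filter[symmetric] Collect_conj_eq[symmetric])
  finally have "h b - h a \<le> (\<Sum>(t, K)\<in>p. measure lborel K *\<^sub>R \<psi>0 t) + e * (b - a) + C * (\<Sum>(t, K)\<in>q. \<nu> K)" .
  moreover have "(\<Sum>(t, K)\<in>p. measure lborel K *\<^sub>R \<psi>0 t) \<le> integral {a..b} \<psi> + e"
    using \<gamma>(2)[of p] p(1) fine(1) unfolding box_real real_norm_def by linarith
  moreover have "C * (\<Sum>(t, K)\<in>q. \<nu> K) \<le> C * e"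
    using q_small C by (intro mult_left_mono) auto
  moreover have "e + e * (b - a) + C * e = e0"
  proof -
    have "e * (1 + (b - a) + C) = e0"
      using nonzero_eq_divide_eq[of "1 + (b - a) + C" e e0] den e_def by linarith
    then show ?thesis by (simp add: algebra_simps)
  qed
  ultimately show "h b - h a \<le> integral {a..b} \<psi> + e0" by linarith
qed

lemma difference_quotient_tendsto:
  fixes G :: "real \<Rightarrow> real"
  assumes "(G has_real_derivative D) (at s)"
  shows "(\<lambda>n. real (Suc n) * (G (s + inverse (real (Suc n))) - G s)) \<longlonglongrightarrow> D"
proof -
  have "(\<lambda>h. (G (s + h) - G s) / h) \<midarrow>0\<rightarrow> D" using assms by (simp add: DERIV_def)
  moreover have "filterlim (\<lambda>n. inverse (real (Suc n))) (at 0) sequentially"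
    using LIMSEQ_inverse_real_of_nat by (intro filterlim_atI) auto
  ultimately have "(\<lambda>n. (G (s + inverse (real (Suc n))) - G s) / inverse (real (Suc n))) \<longlonglongrightarrow> D"
    by (rule filterlim_compose)
  then show ?thesis by (simp add: field_simps)
qed

section \<open>Convex functions, Jensen's inequality and weighted averages\<close>

definition epigraph :: "('a \<Rightarrow> ereal) \<Rightarrow> ('a \<times> real) set" where
  "epigraph F = {(x, r). F x \<le> ereal r}"

text \<open>The lower limit in \<open>lsc_fun\<close> leaves out the point itself, which therefore has to be added to the
  neighbourhood.\<close>
lemma closed_epigraph_lsc:
  fixes F :: "'a::real_normed_vector \<Rightarrow> ereal"
  assumes "lsc_fun F"
  shows "closed (epigraph F)"
proof -
  have "open (- epigraph F)"
  proof (rule Topological_Spaces.openI)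
    fix p assume "p \<in> - epigraph F"
    then obtain x r where p: "p = (x, r)" "ereal r < F x"
      by (cases p) (auto simp: epigraph_def not_le)
    obtain c where c: "ereal r < ereal c" "ereal c < F x"
      using ereal_dense2[OF p(2)] by blast
    have "\<forall>\<^sub>F z in at x. ereal c < F z"
      using assms c(2) by (auto simp: lsc_fun_def intro: less_LiminfD less_le_trans)
    then have "\<forall>\<^sub>F z in nhds x. ereal c < F z"
      using c(2) by (auto simp: eventually_at_filter elim: eventually_mono)
    then obtain V where V: "open V" "x \<in> V" "\<And>z. z \<in> V \<Longrightarrow> ereal c < F z"
      by (auto simp: eventually_nhds)
    have "V \<times> {..<c} \<subseteq> - epigraph F"
    proof
      fix q assume "q \<in> V \<times> {..<c}"
      then have "ereal (snd q) < F (fst q)"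
        using V(3)[of "fst q"] by (auto intro: less_trans[of _ "ereal c"])
      then show "q \<in> - epigraph F" by (auto simp: epigraph_def)
    qed
    moreover have "open (V \<times> {..<c})" "p \<in> V \<times> {..<c}"
      using V(1,2) c(1) p(1) by (auto intro: open_Times)
    ultimately show "\<exists>T. open T \<and> p \<in> T \<and> T \<subseteq> - epigraph F" by blast
  qed
  then show ?thesis by (simp add: closed_def)
qed

lemma convex_epigraph:
  assumes "convex_fun F"
  shows "convex (epigraph F)"
  unfolding convex_alt
proof (clarsimp simp: epigraph_def)
  fix x r y s and u :: real
  assume *: "F x \<le> ereal r" "F y \<le> ereal s" "0 \<le> u" "u \<le> 1"
  have "F ((1 - u) *\<^sub>R x + u *\<^sub>R y) \<le> ereal (1 - u) * F x + ereal u * F y"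
    using assms *(3,4) by (simp add: convex_fun_def)
  also have "\<dots> \<le> ereal (1 - u) * ereal r + ereal u * ereal s"
    using * by (intro add_mono ereal_mult_left_mono) auto
  finally show "F ((1 - u) *\<^sub>R x + u *\<^sub>R y) \<le> ereal ((1 - u) * r + u * s)" by simp
qed

lemma epigraph_fenchel_conjugate:
  "epigraph (fenchel_conjugate g) = (\<Inter>z. {p. ereal (fst p \<bullet> z) - g z \<le> ereal (snd p)})"
  by (auto simp: epigraph_def fenchel_conjugate_def SUP_le_iff)

lemma closed_convex_affine_epigraph:
  fixes c :: ereal and z :: "'a::real_inner"
  shows "closed {p. ereal (fst p \<bullet> z) - c \<le> ereal (snd p)}"
    and "convex {p. ereal (fst p \<bullet> z) - c \<le> ereal (snd p)}"
proof -
  have *: "{p. ereal (fst p \<bullet> z) - c \<le> ereal (snd p)} =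
      (if c = \<infinity> then UNIV else if c = -\<infinity> then {} else {p. (z, -1) \<bullet> p \<le> real_of_ereal c})"
    by (cases c) (auto simp: inner_prod_def inner_commute)
  show "closed {p. ereal (fst p \<bullet> z) - c \<le> ereal (snd p)}"
    unfolding * by (simp add: closed_halfspace_le)
  show "convex {p. ereal (fst p \<bullet> z) - c \<le> ereal (snd p)}"
    unfolding * by (simp add: convex_halfspace_le)
qed

lemma closed_epigraph_fenchel_conjugate: "closed (epigraph (fenchel_conjugate g))"
  and convex_epigraph_fenchel_conjugate: "convex (epigraph (fenchel_conjugate g))"
  unfolding epigraph_fenchel_conjugate
  by (intro closed_INT convex_INT ballI closed_convex_affine_epigraph)+

lemma fenchel_conjugate_neq_MInf:
  assumes "proper_fun g"
  shows "fenchel_conjugate g v \<noteq> -\<infinity>"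
proof -
  obtain z where "g z \<noteq> \<infinity>" "g z \<noteq> -\<infinity>" using assms by (auto simp: proper_fun_def)
  moreover have "ereal (v \<bullet> z) - g z \<le> fenchel_conjugate g v"
    unfolding fenchel_conjugate_def by (rule SUP_upper) simp
  ultimately show ?thesis by (cases "g z") auto
qed

text \<open>If the average lay outside \<open>C\<close>, integrating a separating linear form would give a
  contradiction.\<close>
lemma weighted_average_in_closed_convex:
  fixes w :: "real \<Rightarrow> 'a::{real_inner, banach}"
  assumes C: "closed C" "convex C" and w: "\<And>s. s \<in> I \<Longrightarrow> w s \<in> C"
    and \<rho>: "\<And>s. s \<in> I \<Longrightarrow> 0 \<le> \<rho> s" "(\<rho> has_integral B) I" "0 < B"
    and W: "((\<lambda>s. \<rho> s *\<^sub>R w s) has_integral W) I"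
  shows "inverse B *\<^sub>R W \<in> C"
proof (rule ccontr)
  assume "inverse B *\<^sub>R W \<notin> C"
  then obtain a b where ab: "\<And>z. z \<in> C \<Longrightarrow> a \<bullet> z \<le> b" "b < a \<bullet> (inverse B *\<^sub>R W)"
    using closed_convex_separating_vector[OF C] by blast
  have "((\<lambda>s. a \<bullet> (\<rho> s *\<^sub>R w s)) has_integral a \<bullet> W) I"
    using has_integral_linear[OF W bounded_linear_inner_right] by (simp add: o_def)
  moreover have "((\<lambda>s. \<rho> s * b) has_integral B * b) I"
    using has_integral_mult_left[OF \<rho>(2)] .
  ultimately have "a \<bullet> W \<le> B * b"
    by (rule has_integral_le) (use w ab(1) \<rho>(1) in \<open>auto intro: mult_left_mono\<close>)
  then show False using ab(2) \<rho>(3) by (simp add: field_simps)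
qed

lemma has_integral_PairI:
  fixes x :: "'c::euclidean_space \<Rightarrow> 'a::real_normed_vector" and y :: "'c \<Rightarrow> 'b::real_normed_vector"
  assumes "(x has_integral X) I" "(y has_integral Y) I"
  shows "((\<lambda>s. (x s, y s)) has_integral (X, Y)) I"
proof -
  have "((\<lambda>s. (x s, 0) + (0, y s)) has_integral (X, 0) + (0, Y)) I"
    using has_integral_linear[OF assms(1) bounded_linear_Pair[OF bounded_linear_ident bounded_linear_zero]]
      has_integral_linear[OF assms(2) bounded_linear_Pair[OF bounded_linear_zero bounded_linear_ident]]
    by (intro has_integral_add) (simp_all add: o_def)
  then show ?thesis by simp
qed

text \<open>Jensen's inequality says that the average of the curve \<open>(w, \<phi>)\<close> in the epigraph
  of \<open>F\<close> stays in the epigraph.\<close>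
lemma jensen_weighted_average:
  fixes w :: "real \<Rightarrow> 'a::{real_inner, banach}"
  assumes F: "closed (epigraph F)" "convex (epigraph F)"
    and w: "\<And>s. s \<in> I \<Longrightarrow> F (w s) \<le> ereal (\<phi> s)"
    and \<rho>: "\<And>s. s \<in> I \<Longrightarrow> 0 \<le> \<rho> s" "(\<rho> has_integral B) I" "0 < B"
    and W: "((\<lambda>s. \<rho> s *\<^sub>R w s) has_integral W) I"
    and \<Phi>: "((\<lambda>s. \<rho> s * \<phi> s) has_integral \<Phi>) I"
  shows "F (inverse B *\<^sub>R W) \<le> ereal (inverse B * \<Phi>)"
proof -
  have "inverse B *\<^sub>R (W, \<Phi>) \<in> epigraph F"
  proof (rule weighted_average_in_closed_convex[OF F _ \<rho>])
    show "(w s, \<phi> s) \<in> epigraph F" if "s \<in> I" for s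
      using w[OF that] by (simp add: epigraph_def)
    show "((\<lambda>s. \<rho> s *\<^sub>R (w s, \<phi> s)) has_integral (W, \<Phi>)) I"
      using has_integral_PairI[OF W \<Phi>] by simp
  qed
  then show ?thesis by (simp add: epigraph_def)
qed

text \<open>Weak lower semicontinuity: sublevel sets are slices of the epigraph, and a closed
  convex set is weakly closed.\<close>
lemma weakly_tendsto_eventually_less:
  fixes F :: "'a::{real_inner, banach} \<Rightarrow> ereal"
  assumes F: "closed (epigraph F)" "convex (epigraph F)"
    and w: "weakly_tendsto w p \<F>" and c: "ereal c < F p"
  shows "\<forall>\<^sub>F i in \<F>. ereal c < F (w i)"
proof -
  define C where "C = {z. F z \<le> ereal c}"
  have "C = (\<lambda>z. (z, c)) -` epigraph F" by (auto simp: C_def epigraph_def)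
  then have "closed C"
    using F(1) by (auto intro!: closed_vimage continuous_intros)
  moreover have "convex C"
    unfolding convex_alt
  proof (intro ballI allI impI)
    fix z z' and u :: real assume "z \<in> C" "z' \<in> C" and u: "0 \<le> u \<and> u \<le> 1"
    then have "(1 - u) *\<^sub>R (z, c) + u *\<^sub>R (z', c) \<in> epigraph F"
      using F(2) unfolding convex_alt by (auto simp: C_def epigraph_def)
    then show "(1 - u) *\<^sub>R z + u *\<^sub>R z' \<in> C"
      by (simp add: C_def epigraph_def algebra_simps)
  qed
  ultimately have "\<forall>\<^sub>F i in \<F>. w i \<notin> C"
    by (rule weakly_tendsto_eventually_notin[OF w]) (use c in \<open>simp add: C_def\<close>)
  then show ?thesis by (simp add: C_def not_le)
qed

lemma weakly_tendsto_fst: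
  assumes "weakly_tendsto w p \<F>"
  shows "weakly_tendsto (\<lambda>i. fst (w i)) (fst p) \<F>"
  using assms bounded_linear_compose[OF _ bounded_linear_fst] unfolding weakly_tendsto_def by blast

lemma weakly_tendsto_snd:
  assumes "weakly_tendsto w p \<F>"
  shows "weakly_tendsto (\<lambda>i. snd (w i)) (snd p) \<F>"
  using assms bounded_linear_compose[OF _ bounded_linear_snd] unfolding weakly_tendsto_def by blast

text \<open>The continuous weighted Cesaro theorem is an instance of l'Hopital's rule.\<close>
lemma weighted_average_tendsto:
  fixes \<phi> \<rho> :: "real \<Rightarrow> real"
  assumes \<rho>: "continuous_on {0..} \<rho>" "\<And>s. 0 \<le> s \<Longrightarrow> 0 < \<rho> s"
    and \<phi>: "continuous_on {0..} \<phi>" "(\<phi> \<longlongrightarrow> l) at_top"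
    and B: "filterlim (\<lambda>t. integral {0..t} \<rho>) at_top at_top"
  shows "((\<lambda>t. integral {0..t} (\<lambda>s. \<rho> s * \<phi> s) / integral {0..t} \<rho>) \<longlongrightarrow> l) at_top"
proof (rule lhospital_at_top_at_top[OF B])
  have deriv: "((\<lambda>t. integral {0..t} k) has_real_derivative k t) (at t)"
    if "continuous_on {0..} k" "0 < t" for k :: "real \<Rightarrow> real" and t
  proof -
    have "((\<lambda>t. integral {0..t} k) has_real_derivative k t) (at t within {0..t + 1})"
      using that by (intro integral_has_real_derivative continuous_on_subset[OF that(1)]) auto
    then show ?thesis using that(2) by (simp add: at_within_Icc_at)
  qed
  show "\<forall>\<^sub>F t in at_top. \<rho> t \<noteq> 0"
    using eventually_ge_at_top[of 0] by eventually_elim (use \<rho>(2) in force)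
  show "\<forall>\<^sub>F t in at_top. ((\<lambda>t. integral {0..t} (\<lambda>s. \<rho> s * \<phi> s)) has_real_derivative \<rho> t * \<phi> t) (at t)"
    using eventually_gt_at_top[of 0]
    by eventually_elim (intro deriv continuous_intros \<rho>(1) \<phi>(1))
  show "\<forall>\<^sub>F t in at_top. ((\<lambda>t. integral {0..t} \<rho>) has_real_derivative \<rho> t) (at t)"
    using eventually_gt_at_top[of 0] by eventually_elim (intro deriv \<rho>(1))
  show "((\<lambda>t. \<rho> t * \<phi> t / \<rho> t) \<longlongrightarrow> l) at_top"
  proof (rule Lim_transform_eventually[OF \<phi>(2)])
    show "\<forall>\<^sub>F t in at_top. \<phi> t = \<rho> t * \<phi> t / \<rho> t"
      using eventually_ge_at_top[of 0] by eventually_elim (use \<rho>(2) in force)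
  qed
qed

lemma integral_tendsto_at_top_of_not_integrable:
  fixes \<rho> :: "real \<Rightarrow> real"
  assumes \<rho>: "continuous_on {0..} \<rho>" "\<And>s. 0 \<le> s \<Longrightarrow> 0 < \<rho> s"
    and nint: "\<not> \<rho> absolutely_integrable_on {0<..}"
  shows "filterlim (\<lambda>t. integral {0..t} \<rho>) at_top at_top"
proof (rule ccontr)
  have int: "\<rho> integrable_on {0..t}" for t
    by (intro integrable_continuous_interval continuous_on_subset[OF \<rho>(1)]) auto
  have mono: "integral {0..s} \<rho> \<le> integral {0..t} \<rho>" if "s \<le> t" for s t
    using that less_imp_le[OF \<rho>(2)] by (intro integral_subset_le int) auto
  assume "\<not> ?thesis"
  then obtain M where M: "\<not> (\<forall>\<^sub>F t in at_top. M \<le> integral {0..t} \<rho>)"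
    unfolding filterlim_at_top by blast
  have bound: "integral {0..t} \<rho> < M" for t
  proof (rule ccontr)
    assume "\<not> integral {0..t} \<rho> < M"
    then have "\<forall>s\<ge>t. M \<le> integral {0..s} \<rho>" using mono by force
    then show False using M unfolding eventually_at_top_linorder by blast
  qed
  define k where "k n t = (if t \<in> {0..real n} then \<rho> t else 0)" for n :: nat and t
  have kint: "(k n has_integral integral {0..real n} \<rho>) {0..}" for n
    unfolding k_def using has_integral_restrict[of "{0..real n}" "{0..}" \<rho>] int
    by (simp add: has_integral_iff)
  have "\<rho> integrable_on {0..} \<and> ((\<lambda>n. integral {0..} (k n)) \<longlonglongrightarrow> integral {0..} \<rho>)"
  proof (rule monotone_convergence_increasing)
    show "k n integrable_on {0..}" for n using kint by blast
    show "k n t \<le> k (Suc n) t" if "t \<in> {0..}" for n t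
      using that \<rho>(2)[of t] by (auto simp: k_def)
    show "(\<lambda>n. k n t) \<longlonglongrightarrow> \<rho> t" if "t \<in> {0..}" for t
    proof (rule tendsto_eventually)
      obtain N where "t \<le> real N" using real_arch_simple by blast
      then have "k n t = \<rho> t" if "N \<le> n" for n
        using that \<open>t \<in> {0..}\<close> by (simp add: k_def)
      then show "\<forall>\<^sub>F n in sequentially. k n t = \<rho> t"
        unfolding eventually_sequentially by blast
    qed
    have "0 \<le> integral {0..} (k n)" "integral {0..} (k n) \<le> M" for n
      using bound[of "real n"] mono[of "0" "real n"] integral_unique[OF kint[of n]] by auto
    then show "bounded (range (\<lambda>n. integral {0..} (k n)))"
      by (intro boundedI[of _ M]) auto
  qed
  then have "\<rho> absolutely_integrable_on {0..}"
    using less_imp_le[OF \<rho>(2)] by (intro nonnegative_absolutely_integrable_1) auto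
  then have "\<rho> absolutely_integrable_on {0<..}"
    by (rule set_integrable_subset) auto
  then show False using nint by blast
qed

lemma antimono_nonneg_convergent_at_top:
  fixes h :: "real \<Rightarrow> real"
  assumes "\<And>s t. 0 \<le> s \<Longrightarrow> s \<le> t \<Longrightarrow> h t \<le> h s" "\<And>t. 0 \<le> t \<Longrightarrow> 0 \<le> h t"
  obtains l where "(h \<longlongrightarrow> l) at_top"
proof
  have bdd: "bdd_below (h ` {0..})" using assms(2) by (auto intro: bdd_belowI[of _ 0])
  show "(h \<longlongrightarrow> (INF t\<in>{0..}. h t)) at_top"
  proof (rule decreasing_tendsto)
    show "\<forall>\<^sub>F t in at_top. (INF t\<in>{0..}. h t) \<le> h t"
      using eventually_ge_at_top[of 0] by eventually_elim (intro cINF_lower[OF bdd], simp)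
    fix z assume "(INF t\<in>{0..}. h t) < z"
    then obtain s where s: "0 \<le> s" "h s < z" using cINF_less_iff[OF _ bdd] by auto
    show "\<forall>\<^sub>F t in at_top. h t < z"
      using eventually_ge_at_top[of s] by eventually_elim (use assms(1)[OF s(1)] s(2) in force)
  qed
qed

section \<open>The energy of a trajectory\<close>

lemma subdifferential_real:
  assumes "\<xi> \<in> subdifferential F x" "\<bar>F u\<bar> \<noteq> \<infinity>"
  shows "real_of_ereal (F x) + \<xi> \<bullet> (u - x) \<le> real_of_ereal (F u)"
proof -
  have "\<bar>F x\<bar> \<noteq> \<infinity>" "F x + ereal (\<xi> \<bullet> (u - x)) \<le> F u"
    using assms(1) by (auto simp: subdifferential_def)
  then show ?thesis using assms(2) by (cases "F x"; cases "F u") auto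
qed

locale primal_dual_flow =
  fixes f :: "'a::{real_inner, banach} \<Rightarrow> ereal"
    and g :: "'b::{real_inner, banach} \<Rightarrow> ereal"
    and A :: "'a \<Rightarrow> 'b"
    and \<alpha> \<beta> \<delta> :: "real \<Rightarrow> real"
    and x :: "real \<Rightarrow> 'a" and y :: "real \<Rightarrow> 'b"
  assumes f: "proper_fun f" "convex_fun f" "lsc_fun f"
    and g: "proper_fun g"
    and A: "bounded_linear A"
    and ac: "loc_abs_continuous \<alpha>" "loc_abs_continuous \<beta>" "loc_abs_continuous \<delta>"
    and \<beta>_pos: "\<And>t. t \<ge> 0 \<Longrightarrow> \<beta> t > 0"
    and mono: "antimono_on {0..} (\<lambda>t. \<alpha> t / \<beta> t)" "antimono_on {0..} (\<lambda>t. \<delta> t / \<beta> t)"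
    and c: "min (INF t\<in>{0..}. ereal (\<alpha> t / \<beta> t)) (INF t\<in>{0..}. ereal (\<delta> t / \<beta> t))
              > ereal (onorm A)"
    and traj: "trajectory f g A \<alpha> \<beta> \<delta> x y"
begin

abbreviation gs :: "'b \<Rightarrow> ereal" where "gs \<equiv> fenchel_conjugate g"
abbreviation fr :: "'a \<Rightarrow> real" where "fr u \<equiv> real_of_ereal (f u)"
abbreviation gr :: "'b \<Rightarrow> real" where "gr v \<equiv> real_of_ereal (gs v)"
abbreviation S :: "('a \<times> 'b) set" where "S \<equiv> primal_dual_solutions f g A"
abbreviation E :: "'a \<Rightarrow> 'b \<Rightarrow> real \<Rightarrow> real" where "E \<equiv> energy A \<alpha> \<beta> \<delta> x y"
abbreviation X :: "real \<Rightarrow> 'a" where "X \<equiv> primal_subgrad A \<alpha> \<beta> x y"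
abbreviation Y :: "real \<Rightarrow> 'b" where "Y \<equiv> dual_subgrad A \<beta> \<delta> x y"
abbreviation W :: "real \<Rightarrow> real" where "W t \<equiv> integral {0..t} (\<lambda>s. 1 / \<beta> s)"
abbreviation xh :: "real \<Rightarrow> 'a" where "xh \<equiv> ergodic \<beta> x"
abbreviation yh :: "real \<Rightarrow> 'b" where "yh \<equiv> ergodic \<beta> y"

lemma A_simps: "A (u + u') = A u + A u'" "A (u - u') = A u - A u'" "A (k *\<^sub>R u) = k *\<^sub>R A u" "A 0 = 0"
  using A by (simp_all add: linear_simps bounded_linear.linear linear_0)

lemma f_epigraph: "closed (epigraph f)" "convex (epigraph f)"
  using f closed_epigraph_lsc convex_epigraph by blast+

lemma gs_epigraph: "closed (epigraph gs)" "convex (epigraph gs)"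
  by (fact closed_epigraph_fenchel_conjugate convex_epigraph_fenchel_conjugate)+

lemma f_neq_MInf [simp]: "f u \<noteq> -\<infinity>"
  using f(1) by (simp add: proper_fun_def)

lemma gs_neq_MInf [simp]: "gs v \<noteq> -\<infinity>"
  using g by (rule fenchel_conjugate_neq_MInf)

lemma x_ac: "loc_abs_continuous x" and y_ac: "loc_abs_continuous y"
  and f_finite: "\<And>t. 0 \<le> t \<Longrightarrow> \<bar>f (x t)\<bar> \<noteq> \<infinity>" and gs_finite: "\<And>t. 0 \<le> t \<Longrightarrow> \<bar>gs (y t)\<bar> \<noteq> \<infinity>"
  using traj by (auto simp: trajectory_def)

lemma cont [continuous_intros]:
  "continuous_on {0..} x" "continuous_on {0..} y"
  "continuous_on {0..} (\<lambda>t. fr (x t))" "continuous_on {0..} (\<lambda>t. gr (y t))"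
  "continuous_on {0..} \<alpha>" "continuous_on {0..} \<beta>" "continuous_on {0..} \<delta>"
  using traj ac by (auto simp: trajectory_def intro: loc_abs_continuous_imp_continuous_on)

lemma cont_A [continuous_intros]: "continuous_on T k \<Longrightarrow> continuous_on T (\<lambda>t. A (k t))"
  using bounded_linear.continuous_on[OF A] .

lemma \<beta>_nz: "t \<in> {0..} \<Longrightarrow> \<beta> t \<noteq> 0" using \<beta>_pos by force

lemma cont_weight [continuous_intros]: "continuous_on {0..} (\<lambda>s. 1 / \<beta> s)"
  using \<beta>_nz by (intro continuous_intros) auto

lemma coefficient_lower_bound:
  obtains c0 where "onorm A < c0" "\<And>t. 0 \<le> t \<Longrightarrow> c0 \<le> \<alpha> t / \<beta> t" "\<And>t. 0 \<le> t \<Longrightarrow> c0 \<le> \<delta> t / \<beta> t"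
proof -
  obtain c0 where c0: "ereal (onorm A) < ereal c0"
      "ereal c0 < min (INF t\<in>{0..}. ereal (\<alpha> t / \<beta> t)) (INF t\<in>{0..}. ereal (\<delta> t / \<beta> t))"
    using ereal_dense2[OF c] by blast
  have "ereal c0 \<le> ereal (\<alpha> t / \<beta> t)" "ereal c0 \<le> ereal (\<delta> t / \<beta> t)" if "0 \<le> t" for t
    using c0(2) less_INF_D[of "ereal c0" "\<lambda>t. ereal (\<alpha> t / \<beta> t)" "{0..}" t]
      less_INF_D[of "ereal c0" "\<lambda>t. ereal (\<delta> t / \<beta> t)" "{0..}" t] that
    by (auto intro: less_imp_le)
  then show ?thesis using that c0(1) by auto
qed

lemma onorm_A: "norm (A u) \<le> onorm A * norm u" "0 \<le> onorm A"
  using onorm[OF A] onorm_pos_le[OF A] by auto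

text \<open>At a regular time the inclusions of the system hold with the selections \<open>X\<close> and \<open>Y\<close>, which
  the velocities determine.\<close>
definition regular :: "real \<Rightarrow> bool" where
  "regular t \<longleftrightarrow> (x has_vector_derivative vector_derivative x (at t)) (at t) \<and>
     (y has_vector_derivative vector_derivative y (at t)) (at t) \<and>
     X t \<in> subdifferential f (x t) \<and> Y t \<in> subdifferential gs (y t)"

lemma ae_regular: "\<exists>N. negligible N \<and> (\<forall>t\<ge>0. t \<notin> N \<longrightarrow> 0 < t \<and> regular t)"
proof -
  have "AE t in lebesgue. 0 < t \<longrightarrow> regular t"
    using traj unfolding trajectory_def
  proof (elim conjE AE_mp, intro AE_I2 impI)
    fix t :: real
    assume t: "0 < t" and "0 < t \<longrightarrow>
        (\<exists>x' y'. (x has_vector_derivative x') (at t) \<and> (y has_vector_derivative y') (at t) \<and>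
          (\<exists>\<xi>\<in>subdifferential f (x t). \<alpha> t *\<^sub>R x' + \<beta> t *\<^sub>R adjoint A y' + \<xi> + adjoint A (y t) = 0) \<and>
          (\<exists>\<zeta>\<in>subdifferential gs (y t). \<beta> t *\<^sub>R A x' + \<delta> t *\<^sub>R y' - A (x t) + \<zeta> = 0))"
    then obtain x' y' \<xi> \<zeta> where *: "(x has_vector_derivative x') (at t)" "(y has_vector_derivative y') (at t)"
      "\<xi> \<in> subdifferential f (x t)" "\<alpha> t *\<^sub>R x' + \<beta> t *\<^sub>R adjoint A y' + \<xi> + adjoint A (y t) = 0"
      "\<zeta> \<in> subdifferential gs (y t)" "\<beta> t *\<^sub>R A x' + \<delta> t *\<^sub>R y' - A (x t) + \<zeta> = 0"
      by auto
    have vd: "vector_derivative x (at t) = x'" "vector_derivative y (at t) = y'"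
      using *(1,2) by (auto intro: vector_derivative_at)
    have "\<xi> = (\<alpha> t *\<^sub>R x' + \<beta> t *\<^sub>R adjoint A y' + \<xi> + adjoint A (y t)) + X t"
      "\<zeta> = (\<beta> t *\<^sub>R A x' + \<delta> t *\<^sub>R y' - A (x t) + \<zeta>) + Y t"
      unfolding primal_subgrad_def dual_subgrad_def vd by (simp_all add: algebra_simps)
    then have "\<xi> = X t" "\<zeta> = Y t" unfolding *(4,6) by simp_all
    then show "regular t" using * vd by (simp add: regular_def)
  qed
  then obtain N where "N \<in> null_sets lebesgue" "{t. \<not> (0 < t \<longrightarrow> regular t)} \<subseteq> N"
    by (auto simp: eventually_ae_filter)
  then have "negligible (insert 0 N)" "\<forall>t\<ge>0. t \<notin> insert 0 N \<longrightarrow> 0 < t \<and> regular t"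
    by (auto simp: negligible_iff_null_sets negligible_insert order_less_le)
  then show ?thesis by blast
qed

text \<open>The energy at time \<open>s\<close> with the coefficient quotients frozen at time \<open>t\<close>. It is
  differentiable in \<open>s\<close> wherever the trajectory is, whereas the energy itself need not be.\<close>
definition frozen :: "'a \<Rightarrow> 'b \<Rightarrow> real \<Rightarrow> real \<Rightarrow> real" where
  "frozen u v t s = \<alpha> t / \<beta> t * ((norm (x s - u))\<^sup>2 / 2) + \<delta> t / \<beta> t * ((norm (y s - v))\<^sup>2 / 2)
     + A (x s - u) \<bullet> (y s - v)"

lemma energy_eq_frozen: "E u v t = frozen u v t t"
  by (simp add: energy_def frozen_def)

text \<open>Since the quotients are nonincreasing and multiply squares, freezing them at an
  intermediate time can only enlarge the increment, on either side of that time.\<close>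
lemma energy_increment_le_frozen:
  assumes "0 \<le> r" "r \<le> t" "t \<le> s"
  shows "E u v s - E u v r \<le> frozen u v t s - frozen u v t r"
proof -
  have "\<alpha> s / \<beta> s \<le> \<alpha> t / \<beta> t" "\<alpha> t / \<beta> t \<le> \<alpha> r / \<beta> r"
    "\<delta> s / \<beta> s \<le> \<delta> t / \<beta> t" "\<delta> t / \<beta> t \<le> \<delta> r / \<beta> r"
    using mono assms by (auto simp: monotone_on_def)
  then have "(\<alpha> s / \<beta> s) * ((norm (x s - u))\<^sup>2 / 2) \<le> (\<alpha> t / \<beta> t) * ((norm (x s - u))\<^sup>2 / 2)"
    "(\<alpha> t / \<beta> t) * ((norm (x r - u))\<^sup>2 / 2) \<le> (\<alpha> r / \<beta> r) * ((norm (x r - u))\<^sup>2 / 2)"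
    "(\<delta> s / \<beta> s) * ((norm (y s - v))\<^sup>2 / 2) \<le> (\<delta> t / \<beta> t) * ((norm (y s - v))\<^sup>2 / 2)"
    "(\<delta> t / \<beta> t) * ((norm (y r - v))\<^sup>2 / 2) \<le> (\<delta> r / \<beta> r) * ((norm (y r - v))\<^sup>2 / 2)"
    by (intro mult_right_mono; simp)+
  then show ?thesis unfolding energy_eq_frozen frozen_def by linarith
qed

text \<open>This one-sided bound is what makes \<open>increment_le_integral\<close> applicable. It follows by freezing
  the quotients at the left end point, where they are at most their initial values.\<close>
lemma energy_increment_lipschitz:
  assumes "0 \<le> T"
  obtains C where "0 \<le> C"
    "\<And>r s. 0 \<le> r \<Longrightarrow> r \<le> s \<Longrightarrow> s \<le> T \<Longrightarrow> E u v s - E u v r \<le> C * norm ((x s, y s) - (x r, y r))"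
proof -
  have "continuous_on {0..T} (\<lambda>s. norm (x s - u) + norm (y s - v))"
    by (intro continuous_intros continuous_on_subset[OF cont(1)] continuous_on_subset[OF cont(2)]) auto
  then have "bounded ((\<lambda>s. norm (x s - u) + norm (y s - v)) ` {0..T})"
    by (intro compact_imp_bounded compact_continuous_image) auto
  then obtain R where R: "0 < R" "\<And>s. s \<in> {0..T} \<Longrightarrow> norm (norm (x s - u) + norm (y s - v)) \<le> R"
    by (auto simp: bounded_pos)
  have R': "norm (x s - u) \<le> R" "norm (y s - v) \<le> R" if "0 \<le> s" "s \<le> T" for s
    using R(2)[of s] that norm_ge_zero[of "x s - u"] norm_ge_zero[of "y s - v"]
    unfolding atLeastAtMost_iff real_norm_def by linarith+
  define a0 where "a0 = max 0 (\<alpha> 0 / \<beta> 0)"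
  define d0 where "d0 = max 0 (\<delta> 0 / \<beta> 0)"
  define C where "C = a0 * R + d0 * R + 2 * (onorm A * R)"
  have sq: "((norm p)\<^sup>2 - (norm q)\<^sup>2) / 2 \<le> R * norm (p - q)" if "norm p \<le> R" "norm q \<le> R"
    for p q :: "'c::real_normed_vector"
  proof -
    have "(norm p)\<^sup>2 - (norm q)\<^sup>2 = (norm p + norm q) * (norm p - norm q)"
      by (simp add: power2_eq_square algebra_simps)
    also have "\<dots> \<le> (norm p + norm q) * norm (p - q)"
      by (intro mult_left_mono norm_triangle_ineq2) auto
    also have "\<dots> \<le> (2 * R) * norm (p - q)"
      using that by (intro mult_right_mono) auto
    finally show ?thesis by simp
  qed
  obtain c0 where c0: "onorm A < c0" "\<And>t. 0 \<le> t \<Longrightarrow> c0 \<le> \<alpha> t / \<beta> t" "\<And>t. 0 \<le> t \<Longrightarrow> c0 \<le> \<delta> t / \<beta> t"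
    by (rule coefficient_lower_bound) blast
  have "E u v s - E u v r \<le> C * norm ((x s, y s) - (x r, y r))" if rs: "0 \<le> r" "r \<le> s" "s \<le> T" for r s
  proof -
    define n where "n = norm ((x s, y s) - (x r, y r))"
    have n: "norm (x s - x r) \<le> n" "norm (y s - y r) \<le> n"
      by (simp_all add: n_def norm_fst_le norm_snd_le)
    have coeff: "0 \<le> \<alpha> r / \<beta> r" "\<alpha> r / \<beta> r \<le> a0" "0 \<le> \<delta> r / \<beta> r" "\<delta> r / \<beta> r \<le> d0"
      using c0(1) c0(2)[OF rs(1)] c0(3)[OF rs(1)] onorm_A(2) rs(1)
        monotone_onD[OF mono(1), of 0 r] monotone_onD[OF mono(2), of 0 r]
      unfolding a0_def d0_def by auto
    have "0 \<le> n" by (simp add: n_def)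
    have quad: "k * (((norm p)\<^sup>2 - (norm q)\<^sup>2) / 2) \<le> k0 * R * n"
      if "0 \<le> k" "k \<le> k0" "norm p \<le> R" "norm q \<le> R" "norm (p - q) \<le> n"
      for p q :: "'c::real_normed_vector" and k k0
    proof -
      have "k * (((norm p)\<^sup>2 - (norm q)\<^sup>2) / 2) \<le> k * (R * n)"
        using order_trans[OF sq[OF that(3,4)] mult_left_mono[OF that(5) less_imp_le[OF R(1)]]] that(1)
        by (intro mult_left_mono)
      also have "\<dots> \<le> k0 * (R * n)"
        using that(2) R(1) \<open>0 \<le> n\<close> by (intro mult_right_mono) auto
      finally show ?thesis by (simp add: mult.assoc)
    qed
    have inner_le: "A p \<bullet> q \<le> onorm A * (norm p * norm q)" for p q
    proof -
      have "A p \<bullet> q \<le> norm (A p) * norm q" by (rule norm_cauchy_schwarz)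
      also have "\<dots> \<le> onorm A * norm p * norm q" by (intro mult_right_mono onorm_A) auto
      finally show ?thesis by (simp add: mult.assoc)
    qed
    have "A (x s - x r) \<bullet> (y s - v) \<le> onorm A * (n * R)"
      using inner_le n R'[of s] rs \<open>0 \<le> n\<close> onorm_A(2)
      by (intro order_trans[OF inner_le] mult_left_mono mult_mono) auto
    moreover have "A (x r - u) \<bullet> (y s - y r) \<le> onorm A * (R * n)"
      using inner_le n R'[of r] rs \<open>0 \<le> n\<close> onorm_A(2) R(1)
      by (intro order_trans[OF inner_le] mult_left_mono mult_mono) auto
    moreover have "A (x s - u) \<bullet> (y s - v) - A (x r - u) \<bullet> (y r - v)
        = A (x s - x r) \<bullet> (y s - v) + A (x r - u) \<bullet> (y s - y r)"
      by (simp add: A_simps inner_simps)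
    moreover have "\<alpha> r / \<beta> r * (((norm (x s - u))\<^sup>2 - (norm (x r - u))\<^sup>2) / 2) \<le> a0 * R * n"
      using R'(1)[of s] R'(1)[of r] rs n(1) coeff by (intro quad) auto
    moreover have "\<delta> r / \<beta> r * (((norm (y s - v))\<^sup>2 - (norm (y r - v))\<^sup>2) / 2) \<le> d0 * R * n"
      using R'(2)[of s] R'(2)[of r] rs n(2) coeff by (intro quad) auto
    moreover have "E u v s - E u v r \<le> frozen u v r s - frozen u v r r"
      using rs by (intro energy_increment_le_frozen) auto
    moreover have "C * n = a0 * R * n + d0 * R * n + onorm A * (n * R) + onorm A * (R * n)"
      by (simp add: C_def algebra_simps)
    moreover have "frozen u v r s - frozen u v r r
      = \<alpha> r / \<beta> r * (((norm (x s - u))\<^sup>2 - (norm (x r - u))\<^sup>2) / 2)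
        + \<delta> r / \<beta> r * (((norm (y s - v))\<^sup>2 - (norm (y r - v))\<^sup>2) / 2)
        + (A (x s - u) \<bullet> (y s - v) - A (x r - u) \<bullet> (y r - v))"
      unfolding frozen_def by (simp only: diff_divide_distrib right_diff_distrib)
    ultimately show ?thesis unfolding n_def by linarith
  qed
  moreover have "0 \<le> C"
    using R(1) onorm_A(2) by (simp add: C_def a0_def d0_def)
  ultimately show ?thesis using that by blast
qed

text \<open>The derivative of the frozen energy once the system has been used to eliminate
  the velocities in favour of the subgradients.\<close>
definition slope :: "'a \<Rightarrow> 'b \<Rightarrow> real \<Rightarrow> real" where
  "slope u v t = (X t \<bullet> (u - x t) + Y t \<bullet> (v - y t) + y t \<bullet> A u - v \<bullet> A (x t)) / \<beta> t"

text \<open>The chain rule produces \<open>\<alpha> x' + \<beta> A\<^sup>* y'\<close> tested with \<open>x - u\<close> and \<open>\<beta> A x' + \<delta> y'\<close>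
  tested with \<open>y - v\<close>; these are the left-hand sides of the system, so the velocities disappear.\<close>
lemma frozen_has_derivative:
  assumes "regular t" "0 \<le> t"
  shows "(frozen u v t has_real_derivative slope u v t) (at t)"
proof -
  define x' y' where "x' = vector_derivative x (at t)" and "y' = vector_derivative y (at t)"
  have x: "(x has_derivative (\<lambda>h. h *\<^sub>R x')) (at t)" and y: "(y has_derivative (\<lambda>h. h *\<^sub>R y')) (at t)"
    using assms by (simp_all add: regular_def x'_def y'_def has_vector_derivative_def)
  have Ax: "((\<lambda>s. A (x s - u)) has_derivative (\<lambda>h. A (h *\<^sub>R x'))) (at t)"
    using x by (auto intro!: bounded_linear.has_derivative[OF A] derivative_eq_intros)
  have \<beta>: "\<beta> t \<noteq> 0" using \<beta>_pos[OF assms(2)] by simp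
  have deriv: "(frozen u v t has_derivative (\<lambda>h. \<alpha> t / \<beta> t * ((x t - u) \<bullet> (h *\<^sub>R x'))
      + \<delta> t / \<beta> t * ((y t - v) \<bullet> (h *\<^sub>R y'))
      + (A (x t - u) \<bullet> (h *\<^sub>R y') + A (h *\<^sub>R x') \<bullet> (y t - v)))) (at t)"
    unfolding frozen_def power2_norm_eq_inner
    by (auto intro!: derivative_eq_intros x y Ax simp: inner_commute \<beta>)
  have slope: "slope u v t = \<alpha> t / \<beta> t * ((x t - u) \<bullet> x') + \<delta> t / \<beta> t * ((y t - v) \<bullet> y')
      + (A (x t - u) \<bullet> y' + A x' \<bullet> (y t - v))"
  proof -
    have "X t \<bullet> (u - x t) = \<alpha> t * ((x t - u) \<bullet> x') + \<beta> t * (A (x t - u) \<bullet> y') + A (x t - u) \<bullet> y t"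
      unfolding primal_subgrad_def x'_def[symmetric] y'_def[symmetric] adjoint_inner[OF A]
      by (simp add: inner_simps inner_commute algebra_simps)
    moreover have "Y t \<bullet> (v - y t) = \<beta> t * (A x' \<bullet> (y t - v)) + \<delta> t * ((y t - v) \<bullet> y') - A (x t) \<bullet> (y t - v)"
      unfolding dual_subgrad_def x'_def[symmetric] y'_def[symmetric]
      by (simp add: inner_simps inner_commute algebra_simps)
    moreover have "A (x t - u) \<bullet> y t - A (x t) \<bullet> (y t - v) + y t \<bullet> A u - v \<bullet> A (x t) = 0"
      by (simp add: A_simps inner_simps inner_commute)
    ultimately have "X t \<bullet> (u - x t) + Y t \<bullet> (v - y t) + y t \<bullet> A u - v \<bullet> A (x t)
       = \<alpha> t * ((x t - u) \<bullet> x') + \<delta> t * ((y t - v) \<bullet> y') + \<beta> t * (A (x t - u) \<bullet> y' + A x' \<bullet> (y t - v))"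
      by (simp add: algebra_simps)
    then show ?thesis using \<beta> by (simp add: slope_def add_divide_distrib)
  qed
  show ?thesis
    unfolding has_field_derivative_def
    by (rule has_derivative_eq_rhs[OF deriv]) (simp add: fun_eq_iff slope A_simps(3) algebra_simps)
qed

lemma energy_increment_le_integral:
  assumes "0 \<le> r" "r \<le> T" and \<psi>: "\<psi> integrable_on {r..T}"
    and slope: "\<And>t. r \<le> t \<Longrightarrow> t \<le> T \<Longrightarrow> regular t \<Longrightarrow> slope u v t \<le> \<psi> t"
  shows "E u v T - E u v r \<le> integral {r..T} \<psi>"
proof -
  obtain C where C: "0 \<le> C"
    "\<And>r s. 0 \<le> r \<Longrightarrow> r \<le> s \<Longrightarrow> s \<le> T \<Longrightarrow> E u v s - E u v r \<le> C * norm ((x s, y s) - (x r, y r))"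
    using energy_increment_lipschitz[of T u v] assms(1,2) by auto
  obtain N where N: "negligible N" "\<And>t. 0 \<le> t \<Longrightarrow> t \<notin> N \<Longrightarrow> regular t"
    using ae_regular by blast
  have "abs_continuous_on {0..T + 1} (\<lambda>t. (x t, y t))"
    using x_ac y_ac assms by (intro abs_continuous_on_Pair) (auto simp: loc_abs_continuous_def)
  then have ac: "abs_continuous_on {r..T} (\<lambda>t. (x t, y t))"
    by (rule abs_continuous_on_subset) (use assms in auto)
  show ?thesis
  proof (rule increment_le_integral[OF assms(2) ac C(1) _ \<psi> N(1)])
    fix t assume t: "t \<in> {r..T} - N"
    then have reg: "regular t" "0 \<le> t" using N(2) assms(1) by auto
    show "\<exists>G D. (G has_real_derivative D) (at t) \<and> D \<le> \<psi> t \<and>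
        (\<forall>q s. r \<le> q \<longrightarrow> q \<le> t \<longrightarrow> t \<le> s \<longrightarrow> s \<le> T \<longrightarrow> E u v s - E u v q \<le> G s - G q)"
      using frozen_has_derivative[OF reg] slope[of t] reg t assms(1)
      by (intro exI[of _ "frozen u v t"] exI[of _ "slope u v t"])
         (auto intro: energy_increment_le_frozen)
  qed (use C(2) assms(1) in auto)
qed

text \<open>The Lagrangian difference \<open>L(x(t), v) - L(u, y(t))\<close> as a real number.\<close>
definition gap :: "'a \<Rightarrow> 'b \<Rightarrow> real \<Rightarrow> real" where
  "gap u v t = (fr (x t) + v \<bullet> A (x t) - gr v) - (fr u + y t \<bullet> A u - gr (y t))"

text \<open>The real value of the Bregman divergence when \<open>f u\<close> and \<open>g\<^sup>*(v)\<close> are finite.\<close>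
definition breg :: "'a \<Rightarrow> 'b \<Rightarrow> real \<Rightarrow> real" where
  "breg u v t = (fr u - fr (x t) - X t \<bullet> (u - x t)) + (gr v - gr (y t) - Y t \<bullet> (v - y t))"

lemma bregman_eq:
  assumes "\<bar>f u\<bar> \<noteq> \<infinity>" "\<bar>gs v\<bar> \<noteq> \<infinity>" "0 \<le> t"
  shows "bregman f g A \<alpha> \<beta> \<delta> x y u v t = ereal (breg u v t)"
  using assms f_finite[OF assms(3)] gs_finite[OF assms(3)] unfolding bregman_def breg_def
  by (cases "f u"; cases "gs v"; cases "f (x t)"; cases "gs (y t)") auto

text \<open>The identity behind both estimates: discarding the Bregman term leaves the bound on the
  ergodic gap, discarding the gap, which is nonnegative at a solution, leaves the bound on the
  Bregman integral.\<close>
lemma slope_eq: "slope u v t = - (gap u v t / \<beta> t) - breg u v t / \<beta> t"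
  by (simp add: slope_def gap_def breg_def diff_divide_distrib add_divide_distrib)

lemma breg_nonneg:
  assumes "regular t" "\<bar>f u\<bar> \<noteq> \<infinity>" "\<bar>gs v\<bar> \<noteq> \<infinity>"
  shows "0 \<le> breg u v t"
  using assms subdifferential_real[of "X t" f "x t" u] subdifferential_real[of "Y t" gs "y t" v]
  by (simp add: regular_def breg_def)

lemma solutionD:
  assumes "(u, v) \<in> S"
  shows "- adjoint A v \<in> subdifferential f u" "A u \<in> subdifferential gs v"
    "\<bar>f u\<bar> \<noteq> \<infinity>" "\<bar>gs v\<bar> \<noteq> \<infinity>"
  using assms by (auto simp: primal_dual_solutions_def subdifferential_def)

lemma gap_nonneg:
  assumes "(u, v) \<in> S" "0 \<le> t"
  shows "0 \<le> gap u v t"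
proof -
  have "fr u + (- adjoint A v) \<bullet> (x t - u) \<le> fr (x t)"
    by (rule subdifferential_real[OF solutionD(1)[OF assms(1)] f_finite[OF assms(2)]])
  moreover have "(- adjoint A v) \<bullet> (x t - u) = - (v \<bullet> A (x t)) + v \<bullet> A u"
    using adjoint_inner[OF A, of "x t - u" v] by (simp add: inner_commute A_simps inner_simps)
  moreover have "gr v + A u \<bullet> (y t - v) \<le> gr (y t)"
    by (rule subdifferential_real[OF solutionD(2)[OF assms(1)] gs_finite[OF assms(2)]])
  ultimately show ?thesis
    by (simp add: gap_def inner_simps inner_commute)
qed

lemma energy_antimono:
  assumes "(u, v) \<in> S" "0 \<le> r" "r \<le> t"
  shows "E u v t \<le> E u v r"
proof -
  have "E u v t - E u v r \<le> integral {r..t} (\<lambda>s. 0)"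
  proof (rule energy_increment_le_integral[OF assms(2,3)])
    fix s assume s: "r \<le> s" "s \<le> t" "regular s"
    then have "0 \<le> gap u v s / \<beta> s" "0 \<le> breg u v s / \<beta> s"
      using gap_nonneg[OF assms(1)] breg_nonneg solutionD(3,4)[OF assms(1)] \<beta>_pos[of s] assms(2)
      by auto
    then show "slope u v s \<le> 0" by (simp add: slope_eq)
  qed (rule integrable_0)
  then show ?thesis by simp
qed

text \<open>Coercivity of the energy: by Young's inequality, the coupling term \<open>2 A p \<bullet> q\<close> costs at most
  \<open>\<parallel>A\<parallel>\<close> times the sum of the squares.\<close>
lemma quadratic_lower_bound:
  assumes "c0 \<le> a" "c0 \<le> d"
  shows "(c0 - onorm A) * ((norm p)\<^sup>2 + (norm q)\<^sup>2) \<le> a * (norm p)\<^sup>2 + d * (norm q)\<^sup>2 + 2 * (A p \<bullet> q)"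
proof -
  have "- (A p \<bullet> q) \<le> norm (A p) * norm q"
    using norm_cauchy_schwarz[of "- A p" q] by simp
  also have "\<dots> \<le> onorm A * norm p * norm q" by (intro mult_right_mono onorm_A) auto
  finally have "- (A p \<bullet> q) \<le> onorm A * (norm p * norm q)" by (simp add: mult.assoc)
  moreover have "onorm A * (2 * (norm p * norm q)) \<le> onorm A * ((norm p)\<^sup>2 + (norm q)\<^sup>2)"
    using sum_squares_bound[of "norm p" "norm q"] onorm_A(2) by (intro mult_left_mono) auto
  moreover have "c0 * (norm p)\<^sup>2 \<le> a * (norm p)\<^sup>2" "c0 * (norm q)\<^sup>2 \<le> d * (norm q)\<^sup>2"
    using assms by (auto intro: mult_right_mono)
  ultimately show ?thesis by (simp add: algebra_simps)
qed

lemma energy_lower_bound: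
  obtains \<kappa> where "0 < \<kappa>"
    "\<And>u v t. 0 \<le> t \<Longrightarrow> \<kappa> * ((norm (x t - u))\<^sup>2 + (norm (y t - v))\<^sup>2) \<le> E u v t"
proof -
  obtain c0 where c0: "onorm A < c0" "\<And>t. 0 \<le> t \<Longrightarrow> c0 \<le> \<alpha> t / \<beta> t" "\<And>t. 0 \<le> t \<Longrightarrow> c0 \<le> \<delta> t / \<beta> t"
    by (rule coefficient_lower_bound) blast
  show ?thesis
  proof (rule that[of "(c0 - onorm A) / 2"])
    show "0 < (c0 - onorm A) / 2" using c0(1) by simp
    show "(c0 - onorm A) / 2 * ((norm (x t - u))\<^sup>2 + (norm (y t - v))\<^sup>2) \<le> E u v t" if "0 \<le> t" for u v t
      using divide_right_mono[OF quadratic_lower_bound[OF c0(2)[OF that] c0(3)[OF that]], of 2 "x t - u" "y t - v"]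
      by (simp add: energy_eq_frozen frozen_def add_divide_distrib)
  qed
qed

lemma energy_nonneg: "0 \<le> t \<Longrightarrow> 0 \<le> E u v t"
proof -
  assume "0 \<le> t"
  obtain \<kappa> where \<kappa>: "0 < \<kappa>"
    "\<And>u v t. 0 \<le> t \<Longrightarrow> \<kappa> * ((norm (x t - u))\<^sup>2 + (norm (y t - v))\<^sup>2) \<le> E u v t"
    by (rule energy_lower_bound) blast
  have "0 \<le> \<kappa> * ((norm (x t - u))\<^sup>2 + (norm (y t - v))\<^sup>2)" using \<kappa>(1) by simp
  then show ?thesis using \<kappa>(2)[OF \<open>0 \<le> t\<close>, of u v] by linarith
qed

lemma trajectory_bounded:
  assumes "S \<noteq> {}"
  shows "bounded ((\<lambda>t. (x t, y t)) ` {0..})"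
proof -
  obtain u v where uv: "(u, v) \<in> S" using assms by auto
  obtain \<kappa> where \<kappa>: "0 < \<kappa>"
    "\<And>u v t. 0 \<le> t \<Longrightarrow> \<kappa> * ((norm (x t - u))\<^sup>2 + (norm (y t - v))\<^sup>2) \<le> E u v t"
    by (rule energy_lower_bound) blast
  have "dist (u, v) (x t, y t) \<le> sqrt (E u v 0 / \<kappa>)" if "0 \<le> t" for t
  proof -
    have "\<kappa> * ((norm (x t - u))\<^sup>2 + (norm (y t - v))\<^sup>2) \<le> E u v 0"
      using \<kappa>(2)[OF that, of u v] energy_antimono[OF uv order_refl that] by linarith
    then have "(norm (x t - u))\<^sup>2 + (norm (y t - v))\<^sup>2 \<le> E u v 0 / \<kappa>"
      using \<kappa>(1) by (simp add: field_simps)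
    then show ?thesis
      by (simp add: dist_norm norm_Pair norm_minus_commute[of u] norm_minus_commute[of v])
  qed
  then show ?thesis unfolding bounded_def by blast
qed

section \<open>Ergodic averages\<close>

lemma weight_integral: "((\<lambda>s. 1 / \<beta> s) has_integral W t) {0..t}"
  by (intro integrable_integral integrable_continuous_interval continuous_on_subset[OF cont_weight]) auto

lemma W_pos:
  assumes "0 < t"
  shows "0 < W t"
proof -
  have c: "continuous_on {0..t} (\<lambda>s. 1 / \<beta> s)" by (rule continuous_on_subset[OF cont_weight]) auto
  have pos: "s \<in> {0..t} \<Longrightarrow> 0 < 1 / \<beta> s" for s using \<beta>_pos by simp
  have "0 \<le> W t" using less_imp_le[OF pos] has_integral_integrable[OF weight_integral] by (intro integral_nonneg)
  moreover have "W t \<noteq> 0"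
  proof
    assume "W t = 0"
    then have "\<forall>s\<in>{0..t}. 1 / \<beta> s = 0"
      using integral_eq_0_iff[OF c assms] less_imp_le[OF pos] by blast
    then show False using pos[of 0] assms by auto
  qed
  ultimately show ?thesis by simp
qed

lemma average_integral:
  fixes z :: "real \<Rightarrow> 'c::banach"
  assumes "continuous_on {0..} z" "0 < t"
  shows "((\<lambda>s. (1 / \<beta> s) *\<^sub>R z s) has_integral W t *\<^sub>R ergodic \<beta> z t) {0..t}"
proof -
  have "continuous_on {0..t} (\<lambda>s. (1 / \<beta> s) *\<^sub>R z s)"
    by (rule continuous_on_subset[of "{0..}"]) (auto intro!: continuous_intros assms(1) cont_weight \<beta>_nz)
  then have "((\<lambda>s. (1 / \<beta> s) *\<^sub>R z s) has_integral integral {0..t} (\<lambda>s. (1 / \<beta> s) *\<^sub>R z s)) {0..t}"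
    by (intro integrable_integral integrable_continuous_interval)
  then show ?thesis using W_pos[OF assms(2)] by (simp add: ergodic_def)
qed

lemma averageI:
  fixes z :: "real \<Rightarrow> 'c::banach"
  assumes "((\<lambda>s. (1 / \<beta> s) *\<^sub>R z s) has_integral W t *\<^sub>R m) {0..t}" "0 < t"
  shows "ergodic \<beta> z t = m"
  using integral_unique[OF assms(1)] W_pos[OF assms(2)] by (simp add: ergodic_def)

lemma ergodic_Pair:
  assumes "0 < t"
  shows "ergodic \<beta> (\<lambda>s. (x s, y s)) t = (xh t, yh t)"
  using has_integral_PairI[OF average_integral[OF cont(1) assms] average_integral[OF cont(2) assms]]
  by (intro averageI assms) simp

lemma ergodic_inner:
  fixes z :: "real \<Rightarrow> 'c::{real_inner, banach}"
  assumes "continuous_on {0..} z" "0 < t"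
  shows "ergodic \<beta> (\<lambda>s. w \<bullet> z s) t = w \<bullet> ergodic \<beta> z t"
  using has_integral_linear[OF average_integral[OF assms] bounded_linear_inner_right, of w]
  by (intro averageI assms) (simp add: o_def)

lemma ergodic_bounded:
  assumes "S \<noteq> {}"
  shows "bounded ((\<lambda>t. (xh t, yh t)) ` {0<..})"
proof -
  obtain R where R: "\<And>t. 0 \<le> t \<Longrightarrow> norm (x t, y t) \<le> R"
    using trajectory_bounded[OF assms] by (auto simp: bounded_iff)
  have "norm (xh t, yh t) \<le> R" if "0 < t" for t
  proof -
    have "inverse (W t) *\<^sub>R (W t *\<^sub>R ergodic \<beta> (\<lambda>s. (x s, y s)) t) \<in> cball 0 R"
    proof (rule weighted_average_in_closed_convex[OF _ _ _ _ weight_integral W_pos[OF that]])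
      show "((\<lambda>s. (1 / \<beta> s) *\<^sub>R (x s, y s)) has_integral W t *\<^sub>R ergodic \<beta> (\<lambda>s. (x s, y s)) t) {0..t}"
        by (intro average_integral continuous_intros cont that)
    qed (use R \<beta>_pos in \<open>auto intro: less_imp_le\<close>)
    then show ?thesis using W_pos[OF that] by (simp add: ergodic_Pair[OF that])
  qed
  then show ?thesis by (auto intro: boundedI)
qed

lemma jensen_ergodic:
  fixes z :: "real \<Rightarrow> 'c::{real_inner, banach}"
  assumes F: "closed (epigraph F)" "convex (epigraph F)" "\<And>t. 0 \<le> t \<Longrightarrow> \<bar>F (z t)\<bar> \<noteq> \<infinity>"
    and z: "continuous_on {0..} z" "continuous_on {0..} (\<lambda>t. real_of_ereal (F (z t)))" and t: "0 < t"
  shows "F (ergodic \<beta> z t) \<le> ereal (ergodic \<beta> (\<lambda>t. real_of_ereal (F (z t))) t)"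
proof -
  have "F (inverse (W t) *\<^sub>R (W t *\<^sub>R ergodic \<beta> z t))
      \<le> ereal (inverse (W t) * (W t * ergodic \<beta> (\<lambda>t. real_of_ereal (F (z t))) t))"
  proof (rule jensen_weighted_average[OF F(1,2) _ _ weight_integral W_pos[OF t] average_integral[OF z(1) t]])
    show "((\<lambda>s. 1 / \<beta> s * real_of_ereal (F (z s))) has_integral
        W t * ergodic \<beta> (\<lambda>t. real_of_ereal (F (z t))) t) {0..t}"
      using average_integral[OF z(2) t] by simp
    show "F (z s) \<le> ereal (real_of_ereal (F (z s)))" if "s \<in> {0..t}" for s
      using F(3)[of s] that by (cases "F (z s)") auto
  qed (use \<beta>_pos in \<open>auto intro: less_imp_le\<close>)
  then show ?thesis using W_pos[OF t] by (simp add: mult.assoc[symmetric])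
qed

text \<open>Jensen's inequality for \<open>f\<close> and for \<open>g\<^sup>*\<close> bounds the gap of the averages by the average
  of the gaps, since the remaining terms are affine in the trajectory; the energy inequality
  bounds that average, the Bregman term and the final energy being nonnegative.\<close>
lemma ergodic_gap_bound:
  assumes uv: "\<bar>f u\<bar> \<noteq> \<infinity>" "\<bar>gs v\<bar> \<noteq> \<infinity>" and t: "0 < t"
  shows "\<bar>f (xh t)\<bar> \<noteq> \<infinity>" "\<bar>gs (yh t)\<bar> \<noteq> \<infinity>"
    "(fr (xh t) + v \<bullet> A (xh t) - gr v) - (fr u + yh t \<bullet> A u - gr (yh t)) \<le> inverse (W t) * E u v 0"
proof -
  define \<Phi> where "\<Phi> = ergodic \<beta> (\<lambda>s. fr (x s)) t"
  define \<Psi> where "\<Psi> = ergodic \<beta> (\<lambda>s. gr (y s)) t"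
  have jf: "f (xh t) \<le> ereal \<Phi>" and jg: "gs (yh t) \<le> ereal \<Psi>"
    unfolding \<Phi>_def \<Psi>_def
    by (intro jensen_ergodic f_epigraph gs_epigraph f_finite gs_finite cont t; assumption)+
  show fin: "\<bar>f (xh t)\<bar> \<noteq> \<infinity>" "\<bar>gs (yh t)\<bar> \<noteq> \<infinity>"
    using jf jg by auto
  have "fr (xh t) \<le> \<Phi>" "gr (yh t) \<le> \<Psi>"
    using jf jg fin by (cases "f (xh t)"; cases "gs (yh t)"; simp)+
  have int: "((\<lambda>s. 1 / \<beta> s * gap u v s) has_integral
      W t * ((\<Phi> + v \<bullet> A (xh t) - gr v) - (fr u + yh t \<bullet> A u - \<Psi>))) {0..t}"
  proof -
    have h: "((\<lambda>s. 1 / \<beta> s * fr (x s)) has_integral W t * \<Phi>) {0..t}"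
      "((\<lambda>s. 1 / \<beta> s * gr (y s)) has_integral W t * \<Psi>) {0..t}"
      using average_integral[OF cont(3) t] average_integral[OF cont(4) t] by (simp_all add: \<Phi>_def \<Psi>_def)
    have hx: "((\<lambda>s. 1 / \<beta> s * (adjoint A v \<bullet> x s)) has_integral W t * (adjoint A v \<bullet> xh t)) {0..t}"
      using average_integral[of "\<lambda>s. adjoint A v \<bullet> x s" t] t
      by (simp add: ergodic_inner cont continuous_intros)
    have hy: "((\<lambda>s. 1 / \<beta> s * (A u \<bullet> y s)) has_integral W t * (A u \<bullet> yh t)) {0..t}"
      using average_integral[of "\<lambda>s. A u \<bullet> y s" t] t
      by (simp add: ergodic_inner cont continuous_intros)
    have adj: "adjoint A v \<bullet> p = v \<bullet> A p" for p
      using adjoint_inner[OF A, of p v] by (simp add: inner_commute)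
    have "((\<lambda>s. (1 / \<beta> s * fr (x s) + 1 / \<beta> s * (adjoint A v \<bullet> x s) - 1 / \<beta> s * gr v)
         - (1 / \<beta> s * fr u + 1 / \<beta> s * (A u \<bullet> y s) - 1 / \<beta> s * gr (y s))) has_integral
         (W t * \<Phi> + W t * (adjoint A v \<bullet> xh t) - W t * gr v)
         - (W t * fr u + W t * (A u \<bullet> yh t) - W t * \<Psi>)) {0..t}"
      by (intro has_integral_add has_integral_diff h hx hy has_integral_mult_left weight_integral)
    then show ?thesis
      by (simp add: gap_def adj inner_commute[of _ "A u"] algebra_simps)
  qed
  have "E u v t - E u v 0 \<le> integral {0..t} (\<lambda>s. - (1 / \<beta> s * gap u v s))"
  proof (rule energy_increment_le_integral)
    fix s assume s: "0 \<le> s" "s \<le> t" "regular s"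
    have "0 \<le> breg u v s / \<beta> s"
      using breg_nonneg[OF s(3) uv] \<beta>_pos[OF s(1)] by simp
    then show "slope u v s \<le> - (1 / \<beta> s * gap u v s)" by (simp add: slope_eq)
  qed (use t int in \<open>auto intro: integrable_neg\<close>)
  then have "W t * ((\<Phi> + v \<bullet> A (xh t) - gr v) - (fr u + yh t \<bullet> A u - \<Psi>)) \<le> E u v 0"
    unfolding integral_unique[OF has_integral_neg[OF int]] using energy_nonneg[of t u v] t by linarith
  then have "(\<Phi> + v \<bullet> A (xh t) - gr v) - (fr u + yh t \<bullet> A u - \<Psi>) \<le> inverse (W t) * E u v 0"
    using W_pos[OF t] by (simp add: field_simps)
  then show "(fr (xh t) + v \<bullet> A (xh t) - gr v) - (fr u + yh t \<bullet> A u - gr (yh t)) \<le> inverse (W t) * E u v 0"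
    using \<open>fr (xh t) \<le> \<Phi>\<close> \<open>gr (yh t) \<le> \<Psi>\<close> by linarith
qed

lemma ergodic_gap_le:
  assumes t: "0 < t"
  shows "ergodic_gap f g A \<beta> x y u v t \<le> ereal (inverse (W t) * E u v 0)"
proof (cases "f u = \<infinity> \<or> gs v = \<infinity>")
  case True
  then show ?thesis by (simp add: ergodic_gap_def)
next
  case False
  then have uv: "\<bar>f u\<bar> \<noteq> \<infinity>" "\<bar>gs v\<bar> \<noteq> \<infinity>" by auto
  note bound = ergodic_gap_bound[OF uv t]
  have "ergodic_gap f g A \<beta> x y u v t
      = ereal ((fr (xh t) + v \<bullet> A (xh t) - gr v) - (fr u + yh t \<bullet> A u - gr (yh t)))"
    using False uv bound(1,2) unfolding ergodic_gap_def lagrangian_def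
    by (cases "f u"; cases "gs v"; cases "f (xh t)"; cases "gs (yh t)") auto
  then show ?thesis using bound(3) by simp
qed

section \<open>The Bregman integral\<close>

text \<open>Neither measurability nor integrability of the Bregman term is known beforehand. It is measurable
  as an almost everywhere limit of continuous difference quotients of the frozen energy. Truncated at
  height \<open>n\<close> it is integrable, so the energy inequality applies with a bound independent of \<open>n\<close>, and
  monotone convergence removes the truncation.\<close>
lemma bregman_integral_le:
  assumes uv: "(u, v) \<in> S" and T: "0 \<le> T"
  shows "(\<lambda>s. breg u v s / \<beta> s) absolutely_integrable_on {0..T}"
    "integral {0..T} (\<lambda>s. breg u v s / \<beta> s) \<le> E u v 0"
proof -
  note fin = solutionD(3,4)[OF uv]
  obtain N where N: "negligible N" "\<And>t. 0 \<le> t \<Longrightarrow> t \<notin> N \<Longrightarrow> regular t"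
    using ae_regular by blast
  define D where "D s = (if s \<in> N then 0 else breg u v s / \<beta> s)" for s
  have D_nonneg: "0 \<le> D s" if "s \<in> {0..T}" for s
    using that breg_nonneg[OF N(2) fin, of s] \<beta>_pos[of s] by (auto simp: D_def)
  define q where "q n s = - (real (Suc n) * (frozen u v s (s + inverse (real (Suc n))) - frozen u v s s))
      - gap u v s / \<beta> s" for n s
  have q_cont: "continuous_on {0..T} (q n)" for n
  proof -
    have "continuous_on {0..} (\<lambda>s. x (s + inverse (real (Suc n))))"
      "continuous_on {0..} (\<lambda>s. y (s + inverse (real (Suc n))))"
      by (auto intro!: continuous_on_compose2[OF cont(1)] continuous_on_compose2[OF cont(2)] continuous_intros)
    then have "continuous_on {0..} (q n)"
      unfolding q_def frozen_def gap_def
      by (intro continuous_intros) (use \<beta>_nz in auto)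
    then show ?thesis by (rule continuous_on_subset) auto
  qed
  have D_meas: "D \<in> borel_measurable (lebesgue_on {0..T})"
  proof (rule borel_measurable_LIMSEQ_real)
    show "(\<lambda>s. if s \<in> N then 0 else q n s) \<in> borel_measurable (lebesgue_on {0..T})" for n
    proof (rule measurable_If)
      show "q n \<in> borel_measurable (lebesgue_on {0..T})"
        using q_cont by (intro continuous_imp_measurable_on_sets_lebesgue) auto
      have "N \<in> sets lebesgue" using N(1) by (simp add: negligible_imp_sets)
      then show "{s \<in> space (lebesgue_on {0..T}). s \<in> N} \<in> sets (lebesgue_on {0..T})"
        by (auto simp: sets_restrict_space space_restrict_space)
    qed simp
    show "(\<lambda>n. if s \<in> N then 0 else q n s) \<longlonglongrightarrow> D s" if "s \<in> space (lebesgue_on {0..T})" for s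
    proof (cases "s \<in> N")
      case False
      have s: "0 \<le> s" using that by (simp add: space_restrict_space)
      have "(\<lambda>n. q n s) \<longlonglongrightarrow> - slope u v s - gap u v s / \<beta> s"
        unfolding q_def
        by (intro tendsto_intros difference_quotient_tendsto frozen_has_derivative N(2) s False)
      then show ?thesis using False by (simp add: D_def slope_eq)
    qed (simp add: D_def)
  qed
  define Dn where "Dn n s = min (D s) (real n)" for n s
  have Dn_int: "Dn n integrable_on {0..T}" for n
  proof (rule measurable_bounded_by_integrable_imp_integrable_real)
    show "Dn n \<in> borel_measurable (lebesgue_on {0..T})"
      unfolding Dn_def using D_meas by (intro borel_measurable_min) auto
    show "(\<lambda>_. real n) integrable_on {0..T}" by (rule integrable_const_ivl)
    show "\<bar>Dn n s\<bar> \<le> real n" if "s \<in> {0..T}" for s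
      using D_nonneg[OF that] by (simp add: Dn_def)
  qed simp
  have Dn_le: "integral {0..T} (Dn n) \<le> E u v 0" for n
  proof -
    have "E u v T - E u v 0 \<le> integral {0..T} (\<lambda>s. - Dn n s)"
    proof (rule energy_increment_le_integral[OF order_refl T])
      fix s assume s: "0 \<le> s" "s \<le> T" "regular s"
      have "0 \<le> gap u v s / \<beta> s" "0 \<le> breg u v s / \<beta> s"
        using gap_nonneg[OF uv s(1)] breg_nonneg[OF s(3) fin] \<beta>_pos[OF s(1)] by auto
      then have "Dn n s \<le> breg u v s / \<beta> s" by (simp add: Dn_def D_def min.coboundedI1)
      then show "slope u v s \<le> - Dn n s"
        using \<open>0 \<le> gap u v s / \<beta> s\<close> by (simp add: slope_eq)
    qed (intro integrable_neg Dn_int)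
    then show ?thesis using energy_nonneg[OF T, of u v] by simp
  qed
  have lim: "D integrable_on {0..T} \<and> ((\<lambda>n. integral {0..T} (Dn n)) \<longlonglongrightarrow> integral {0..T} D)"
  proof (rule monotone_convergence_increasing[OF Dn_int])
    show "Dn n s \<le> Dn (Suc n) s" for n s by (simp add: Dn_def)
    show "(\<lambda>n. Dn n s) \<longlonglongrightarrow> D s" for s
    proof (rule tendsto_eventually)
      obtain m where "D s \<le> real m" using real_arch_simple by blast
      then have "Dn n s = D s" if "m \<le> n" for n using that by (simp add: Dn_def)
      then show "\<forall>\<^sub>F n in sequentially. Dn n s = D s" unfolding eventually_sequentially by blast
    qed
    have "0 \<le> integral {0..T} (Dn n)" for n
      using D_nonneg by (intro integral_nonneg Dn_int) (simp add: Dn_def)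
    then show "bounded (range (\<lambda>n. integral {0..T} (Dn n)))"
      using Dn_le by (intro boundedI[of _ "E u v 0"]) auto
  qed
  then have "D absolutely_integrable_on {0..T}"
    using D_nonneg by (intro nonnegative_absolutely_integrable_1) auto
  then show "(\<lambda>s. breg u v s / \<beta> s) absolutely_integrable_on {0..T}"
    by (rule absolutely_integrable_spike[OF _ N(1)]) (simp add: D_def)
  have "integral {0..T} (\<lambda>s. breg u v s / \<beta> s) = integral {0..T} D"
    by (rule integral_spike[OF N(1)]) (simp add: D_def)
  also have "\<dots> \<le> E u v 0"
    using lim Dn_le by (intro LIMSEQ_le_const2) auto
  finally show "integral {0..T} (\<lambda>s. breg u v s / \<beta> s) \<le> E u v 0" .
qed

section \<open>Weak limit points of the ergodic trajectory\<close>

text \<open>In the limit the ergodic gap gives \<open>L(p, v) \<le> L(u, q)\<close> for all \<open>u\<close> and \<open>v\<close>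
  of finite value; the choices \<open>v = q\<close> and \<open>u = p\<close> are the two subgradient inequalities.\<close>
lemma weak_limit_point_in_solutions:
  assumes W: "filterlim W at_top at_top" and S: "S \<noteq> {}"
    and P: "weak_subseq_limit_point (\<lambda>t. (xh t, yh t)) P"
  shows "P \<in> S"
proof -
  obtain p q where Ppq: "P = (p, q)" by (cases P)
  obtain \<tau> where \<tau>: "filterlim \<tau> at_top sequentially"
    "weakly_tendsto (\<lambda>k. (xh (\<tau> k), yh (\<tau> k))) P sequentially"
    using P by (auto simp: weak_subseq_limit_point_def)
  have wx: "weakly_tendsto (\<lambda>k. xh (\<tau> k)) p sequentially"
    and wy: "weakly_tendsto (\<lambda>k. yh (\<tau> k)) q sequentially"
    using weakly_tendsto_fst[OF \<tau>(2)] weakly_tendsto_snd[OF \<tau>(2)] by (simp_all add: Ppq)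
  have \<tau>_pos: "\<forall>\<^sub>F k in sequentially. 0 < \<tau> k"
    using \<tau>(1) by (simp add: filterlim_at_top_dense)
  have W_inv: "(\<lambda>k. inverse (W (\<tau> k))) \<longlonglongrightarrow> 0"
    by (rule tendsto_inverse_0_at_top[OF filterlim_compose[OF W \<tau>(1)]])
  \<comment> \<open>Strict lower bounds \<open>c1\<close> and \<open>c2\<close> stand in for \<open>f p\<close> and \<open>g\<^sup>*(q)\<close>, whose finiteness is only
    derived afterwards.\<close>
  have key: "c1 + v \<bullet> A p - gr v - (fr u + q \<bullet> A u) + c2 \<le> 0"
    if uv: "\<bar>f u\<bar> \<noteq> \<infinity>" "\<bar>gs v\<bar> \<noteq> \<infinity>" and c: "ereal c1 < f p" "ereal c2 < gs q" for u v c1 c2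
  proof (rule tendsto_le)
    have "(\<lambda>k. adjoint A v \<bullet> xh (\<tau> k)) \<longlonglongrightarrow> adjoint A v \<bullet> p"
      using wx by (simp add: weakly_tendsto_iff_inner)
    then have "(\<lambda>k. v \<bullet> A (xh (\<tau> k))) \<longlonglongrightarrow> v \<bullet> A p"
      using adjoint_inner[OF A] by (simp add: inner_commute)
    moreover have "(\<lambda>k. yh (\<tau> k) \<bullet> A u) \<longlonglongrightarrow> q \<bullet> A u"
      using wy by (simp add: weakly_tendsto_iff_inner inner_commute[of _ "A u"])
    ultimately show "(\<lambda>k. c1 + v \<bullet> A (xh (\<tau> k)) - gr v - (fr u + yh (\<tau> k) \<bullet> A u) + c2)
        \<longlonglongrightarrow> c1 + v \<bullet> A p - gr v - (fr u + q \<bullet> A u) + c2"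
      by (intro tendsto_add tendsto_diff tendsto_const)
    show "(\<lambda>k. inverse (W (\<tau> k)) * E u v 0) \<longlonglongrightarrow> 0"
      using tendsto_mult_right[OF W_inv, of "E u v 0"] by simp
    show "\<forall>\<^sub>F k in sequentially. c1 + v \<bullet> A (xh (\<tau> k)) - gr v - (fr u + yh (\<tau> k) \<bullet> A u) + c2
        \<le> inverse (W (\<tau> k)) * E u v 0"
      using \<tau>_pos weakly_tendsto_eventually_less[OF f_epigraph wx c(1)]
        weakly_tendsto_eventually_less[OF gs_epigraph wy c(2)]
    proof eventually_elim
      case (elim k)
      note bound = ergodic_gap_bound[OF uv elim(1)]
      have "c1 < fr (xh (\<tau> k))" "c2 < gr (yh (\<tau> k))"
        using elim(2,3) bound(1,2) by (cases "f (xh (\<tau> k))"; cases "gs (yh (\<tau> k))"; simp)+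
      then show ?case using bound(3) by linarith
    qed
  qed simp
  obtain u0 v0 where uv0: "\<bar>f u0\<bar> \<noteq> \<infinity>" "\<bar>gs v0\<bar> \<noteq> \<infinity>"
  proof -
    obtain u0 v0 where "(u0, v0) \<in> S" using S by auto
    from solutionD(3,4)[OF this] show ?thesis by (rule that)
  qed
  obtain c1 where c1: "ereal c1 < f p" using ereal_dense2[of "-\<infinity>" "f p"] by auto
  obtain c2 where c2: "ereal c2 < gs q" using ereal_dense2[of "-\<infinity>" "gs q"] by auto
  have fp: "\<bar>f p\<bar> \<noteq> \<infinity>"
  proof -
    have "f p \<noteq> \<infinity>"
    proof
      assume "f p = \<infinity>"
      then have "c + v0 \<bullet> A p - gr v0 - (fr u0 + q \<bullet> A u0) + c2 \<le> 0" for c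
        using key[OF uv0 _ c2] by simp
      from this[of "1 - (v0 \<bullet> A p - gr v0 - (fr u0 + q \<bullet> A u0) + c2)"] show False by simp
    qed
    then show ?thesis using f_neq_MInf[of p] by (cases "f p") auto
  qed
  have gq: "\<bar>gs q\<bar> \<noteq> \<infinity>"
  proof -
    have "gs q \<noteq> \<infinity>"
    proof
      assume "gs q = \<infinity>"
      then have "c1 + v0 \<bullet> A p - gr v0 - (fr u0 + q \<bullet> A u0) + c \<le> 0" for c
        using key[OF uv0 c1] by simp
      from this[of "1 - (c1 + v0 \<bullet> A p - gr v0 - (fr u0 + q \<bullet> A u0))"] show False by simp
    qed
    then show ?thesis using gs_neq_MInf[of q] by (cases "gs q") auto
  qed
  have saddle: "fr p + v \<bullet> A p - gr v - (fr u + q \<bullet> A u) + gr q \<le> 0"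
    if uv: "\<bar>f u\<bar> \<noteq> \<infinity>" "\<bar>gs v\<bar> \<noteq> \<infinity>" for u v
  proof (rule field_le_epsilon)
    fix e :: real assume "0 < e"
    then have "ereal (fr p - e / 2) < f p" "ereal (gr q - e / 2) < gs q"
      using fp gq by (cases "f p"; cases "gs q"; simp)+
    from key[OF uv this] show "fr p + v \<bullet> A p - gr v - (fr u + q \<bullet> A u) + gr q \<le> 0 + e" by simp
  qed
  have "- adjoint A q \<in> subdifferential f p"
    unfolding subdifferential_def
  proof (intro CollectI conjI allI fp)
    fix z
    show "f p + ereal (- adjoint A q \<bullet> (z - p)) \<le> f z"
    proof (cases "f z = \<infinity>")
      case False
      then have fz: "\<bar>f z\<bar> \<noteq> \<infinity>" using f_neq_MInf[of z] by (cases "f z") auto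
      have adj: "adjoint A q \<bullet> w = q \<bullet> A w" for w
        using adjoint_inner[OF A, of w q] by (simp add: inner_commute)
      have "fr p + (- adjoint A q \<bullet> (z - p)) \<le> fr z"
        using saddle[OF _ gq, of z] fz by (simp add: adj inner_diff_right)
      then show ?thesis using fp False by (cases "f p"; cases "f z") auto
    qed simp
  qed
  moreover have "A p \<in> subdifferential gs q"
    unfolding subdifferential_def
  proof (intro CollectI conjI allI gq)
    fix z
    show "gs q + ereal (A p \<bullet> (z - q)) \<le> gs z"
    proof (cases "gs z = \<infinity>")
      case False
      then have "\<bar>gs z\<bar> \<noteq> \<infinity>" using gs_neq_MInf[of z] by (cases "gs z") auto
      then have "gr q + A p \<bullet> (z - q) \<le> gr z"
        using saddle[OF fp, of z] by (simp add: inner_diff_right inner_commute)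
      then show ?thesis using gq False by (cases "gs q"; cases "gs z") auto
    qed simp
  qed
  ultimately show ?thesis by (simp add: primal_dual_solutions_def Ppq)
qed

text \<open>Opial's argument in the metric of the energy. With constant quotients the quadratic terms cancel in
  the difference of the energies at two solutions, so an affine function of the trajectory
  converges; its linear part \<open>w\<close> pairs with \<open>P1 - P2\<close> to twice the
  quadratic form of the energy at \<open>P1 - P2\<close>.\<close>
lemma ergodic_limit_point_unique:
  assumes W: "filterlim W at_top at_top"
    and const: "\<And>t. 0 \<le> t \<Longrightarrow> \<alpha> t / \<beta> t = a" "\<And>t. 0 \<le> t \<Longrightarrow> \<delta> t / \<beta> t = d"
    and P1: "P1 \<in> S" "weak_subseq_limit_point (\<lambda>t. (xh t, yh t)) P1"
    and P2: "P2 \<in> S" "weak_subseq_limit_point (\<lambda>t. (xh t, yh t)) P2"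
  shows "P1 = P2"
proof -
  obtain u1 v1 u2 v2 where uv: "P1 = (u1, v1)" "P2 = (u2, v2)" by (cases P1; cases P2)
  define du dv where "du = u1 - u2" and "dv = v1 - v2"
  define w where "w = (a *\<^sub>R du + adjoint A dv, d *\<^sub>R dv + A du)"
  have w_inner: "w \<bullet> (p, q) = a * (du \<bullet> p) + A p \<bullet> dv + d * (dv \<bullet> q) + A du \<bullet> q" for p q
    using adjoint_inner[OF A, of p dv] by (simp add: w_def inner_simps inner_commute)
  define K where "K = a * ((norm u1)\<^sup>2 - (norm u2)\<^sup>2) / 2 + d * ((norm v1)\<^sup>2 - (norm v2)\<^sup>2) / 2
      + A u1 \<bullet> v1 - A u2 \<bullet> v2"
  have diff: "w \<bullet> (x t, y t) = K - (E u1 v1 t - E u2 v2 t)" if "0 \<le> t" for t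
    unfolding energy_eq_frozen frozen_def const(1)[OF that] const(2)[OF that] w_inner K_def
      power2_norm_eq_inner du_def dv_def
    by (simp add: A_simps inner_simps inner_commute field_simps)
  obtain l1 where l1: "(E u1 v1 \<longlongrightarrow> l1) at_top"
    using antimono_nonneg_convergent_at_top[of "E u1 v1"] energy_antimono energy_nonneg P1(1) uv(1) by blast
  obtain l2 where l2: "(E u2 v2 \<longlongrightarrow> l2) at_top"
    using antimono_nonneg_convergent_at_top[of "E u2 v2"] energy_antimono energy_nonneg P2(1) uv(2) by blast
  have "((\<lambda>t. K - (E u1 v1 t - E u2 v2 t)) \<longlongrightarrow> K - (l1 - l2)) at_top"
    by (intro tendsto_intros l1 l2)
  then have lim: "((\<lambda>t. w \<bullet> (x t, y t)) \<longlongrightarrow> K - (l1 - l2)) at_top"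
    by (rule Lim_transform_eventually)
       (use eventually_ge_at_top[of 0] in eventually_elim, simp add: diff)
  have zc: "continuous_on {0..} (\<lambda>t. (x t, y t))" by (intro continuous_intros)
  have "((\<lambda>t. integral {0..t} (\<lambda>s. 1 / \<beta> s * (w \<bullet> (x s, y s))) / W t) \<longlongrightarrow> K - (l1 - l2)) at_top"
    by (rule weighted_average_tendsto[OF cont_weight _ _ lim W])
       (use \<beta>_pos in \<open>auto intro!: continuous_intros\<close>)
  moreover have "\<forall>\<^sub>F t in at_top. integral {0..t} (\<lambda>s. 1 / \<beta> s * (w \<bullet> (x s, y s))) / W t = w \<bullet> (xh t, yh t)"
    using eventually_gt_at_top[of 0]
  proof eventually_elim
    case (elim t)
    have "w \<bullet> (xh t, yh t) = ergodic \<beta> (\<lambda>s. w \<bullet> (x s, y s)) t"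
      using ergodic_inner[OF zc elim, of w] ergodic_Pair[OF elim] by simp
    then show ?case by (simp add: ergodic_def field_simps)
  qed
  ultimately have elim: "((\<lambda>t. w \<bullet> (xh t, yh t)) \<longlongrightarrow> K - (l1 - l2)) at_top"
    by (rule Lim_transform_eventually)
  have "w \<bullet> P = K - (l1 - l2)" if P: "weak_subseq_limit_point (\<lambda>t. (xh t, yh t)) P" for P
  proof -
    obtain \<tau> where \<tau>: "filterlim \<tau> at_top sequentially"
      "weakly_tendsto (\<lambda>k. (xh (\<tau> k), yh (\<tau> k))) P sequentially"
      using P by (auto simp: weak_subseq_limit_point_def)
    have "(\<lambda>k. w \<bullet> (xh (\<tau> k), yh (\<tau> k))) \<longlonglongrightarrow> w \<bullet> P"
      using \<tau>(2) unfolding weakly_tendsto_iff_inner by blast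
    then show ?thesis
      using LIMSEQ_unique filterlim_compose[OF elim \<tau>(1)] by blast
  qed
  then have "w \<bullet> (P1 - P2) = 0" using P1(2) P2(2) by (simp add: inner_diff_right)
  then have zero: "a * (norm du)\<^sup>2 + d * (norm dv)\<^sup>2 + 2 * (A du \<bullet> dv) = 0"
    using w_inner[of du dv] by (simp add: uv du_def dv_def power2_norm_eq_inner)
  obtain c0 where c0: "onorm A < c0" "\<And>t. 0 \<le> t \<Longrightarrow> c0 \<le> \<alpha> t / \<beta> t" "\<And>t. 0 \<le> t \<Longrightarrow> c0 \<le> \<delta> t / \<beta> t"
    by (rule coefficient_lower_bound) blast
  have "c0 \<le> a" "c0 \<le> d" using c0(2)[of 0] c0(3)[of 0] const[of 0] by auto
  from quadratic_lower_bound[OF this, of du dv] zero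
  have "(c0 - onorm A) * ((norm du)\<^sup>2 + (norm dv)\<^sup>2) \<le> 0" by simp
  then have "(norm du)\<^sup>2 + (norm dv)\<^sup>2 \<le> 0" using c0(1) by (simp add: mult_le_0_iff)
  then have "du = 0" "dv = 0" by (simp_all add: sum_power2_le_zero_iff)
  then show ?thesis by (simp add: uv du_def dv_def)
qed

end

section \<open>The convergence theorem\<close>

theorem theoremA2:
  fixes f :: "'a::{real_inner, banach} \<Rightarrow> ereal"
    and g :: "'b::{real_inner, banach} \<Rightarrow> ereal"
    and A :: "'a \<Rightarrow> 'b"
    and \<alpha> \<beta> \<delta> :: "real \<Rightarrow> real"
    and x :: "real \<Rightarrow> 'a" and y :: "real \<Rightarrow> 'b"
  defines "S \<equiv> primal_dual_solutions f g A"
    and "xh \<equiv> ergodic \<beta> x" and "yh \<equiv> ergodic \<beta> y"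
  assumes f: "proper_fun f" "convex_fun f" "lsc_fun f"
    and g: "proper_fun g" "convex_fun g" "lsc_fun g"
    and A: "bounded_linear A"
    and S_nonempty: "S \<noteq> {}"
    and ac: "loc_abs_continuous \<alpha>" "loc_abs_continuous \<beta>" "loc_abs_continuous \<delta>"
    and \<beta>_pos: "\<And>t. t \<ge> 0 \<Longrightarrow> \<beta> t > 0"
    and mono: "antimono_on {0..} (\<lambda>t. \<alpha> t / \<beta> t)" "antimono_on {0..} (\<lambda>t. \<delta> t / \<beta> t)"
    and c: "min (INF t\<in>{0..}. ereal (\<alpha> t / \<beta> t)) (INF t\<in>{0..}. ereal (\<delta> t / \<beta> t))
              > ereal (onorm A)"
    and traj: "trajectory f g A \<alpha> \<beta> \<delta> x y"
  shows
    "(bounded ((\<lambda>t. (x t, y t)) ` {0..}) \<and>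
      bounded ((\<lambda>t. (xh t, yh t)) ` {0<..}) \<and>
      (\<exists>p. weak_subseq_limit_point (\<lambda>t. (x t, y t)) p) \<and>
      (\<exists>p. weak_subseq_limit_point (\<lambda>t. (xh t, yh t)) p))
   \<and> (\<forall>u v. \<forall>t>0. ergodic_gap f g A \<beta> x y u v t
        \<le> ereal (inverse (integral {0..t} (\<lambda>s. 1 / \<beta> s)) * energy A \<alpha> \<beta> \<delta> x y u v 0))
   \<and> (\<forall>(u, v)\<in>S. \<forall>t\<ge>0.
        (\<forall>s\<ge>0. \<bar>bregman f g A \<alpha> \<beta> \<delta> x y u v s\<bar> \<noteq> \<infinity>) \<and>
        (\<lambda>s. real_of_ereal (bregman f g A \<alpha> \<beta> \<delta> x y u v s) / \<beta> s) absolutely_integrable_on {0..t} \<and>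
        integral {0..t} (\<lambda>s. real_of_ereal (bregman f g A \<alpha> \<beta> \<delta> x y u v s) / \<beta> s)
          \<le> energy A \<alpha> \<beta> \<delta> x y u v 0)
   \<and> (\<not> (\<lambda>s. 1 / \<beta> s) absolutely_integrable_on {0<..} \<longrightarrow>
        (\<forall>p. weak_subseq_limit_point (\<lambda>t. (xh t, yh t)) p \<longrightarrow> p \<in> S))
   \<and> (\<not> (\<lambda>s. 1 / \<beta> s) absolutely_integrable_on {0<..} \<and>
      (((\<lambda>t. \<alpha> t / \<beta> t) constant_on {0..} \<and> (\<lambda>t. \<delta> t / \<beta> t) constant_on {0..}) \<or> is_singleton S) \<longrightarrow>
        (\<exists>p\<in>S. weakly_tendsto (\<lambda>t. (xh t, yh t)) p at_top))"
proof -
  interpret flow: primal_dual_flow f g A \<alpha> \<beta> \<delta> x y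
    by (rule primal_dual_flow.intro) (fact f g A ac \<beta>_pos mono c traj)+
  note S_ne = S_nonempty[unfolded S_def]
  have bdd: "bounded ((\<lambda>t. (x t, y t)) ` {0..})"
    by (rule flow.trajectory_bounded[OF S_ne])
  have bddh: "bounded ((\<lambda>t. (xh t, yh t)) ` {0<..})"
    unfolding xh_def yh_def by (rule flow.ergodic_bounded[OF S_ne])
  have lim: "\<exists>p. weak_subseq_limit_point (\<lambda>t. (x t, y t)) p"
    by (intro bounded_curve_has_weak_limit_point bounded_subset[OF bdd]) auto
  have limh: "\<exists>p. weak_subseq_limit_point (\<lambda>t. (xh t, yh t)) p"
    by (intro bounded_curve_has_weak_limit_point bddh)
  have gap: "\<forall>u v. \<forall>t>0. ergodic_gap f g A \<beta> x y u v t
        \<le> ereal (inverse (integral {0..t} (\<lambda>s. 1 / \<beta> s)) * energy A \<alpha> \<beta> \<delta> x y u v 0)"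
    by (intro allI impI flow.ergodic_gap_le)
  have breg: "\<forall>(u, v)\<in>S. \<forall>t\<ge>0.
        (\<forall>s\<ge>0. \<bar>bregman f g A \<alpha> \<beta> \<delta> x y u v s\<bar> \<noteq> \<infinity>) \<and>
        (\<lambda>s. real_of_ereal (bregman f g A \<alpha> \<beta> \<delta> x y u v s) / \<beta> s) absolutely_integrable_on {0..t} \<and>
        integral {0..t} (\<lambda>s. real_of_ereal (bregman f g A \<alpha> \<beta> \<delta> x y u v s) / \<beta> s)
          \<le> energy A \<alpha> \<beta> \<delta> x y u v 0"
  proof clarify
    fix u v and t :: real assume uv: "(u, v) \<in> S" and t: "0 \<le> t"
    note uv' = uv[unfolded S_def]
    have eq: "bregman f g A \<alpha> \<beta> \<delta> x y u v s = ereal (flow.breg u v s)" if "0 \<le> s" for s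
      by (intro flow.bregman_eq flow.solutionD(3,4)[OF uv'] that)
    note int = flow.bregman_integral_le[OF uv' t]
    have "(\<lambda>s. real_of_ereal (bregman f g A \<alpha> \<beta> \<delta> x y u v s) / \<beta> s) absolutely_integrable_on {0..t}"
      by (rule absolutely_integrable_spike[OF int(1) negligible_empty]) (simp add: eq)
    moreover have "integral {0..t} (\<lambda>s. real_of_ereal (bregman f g A \<alpha> \<beta> \<delta> x y u v s) / \<beta> s)
        = integral {0..t} (\<lambda>s. flow.breg u v s / \<beta> s)"
      by (rule integral_cong) (simp add: eq)
    ultimately show "(\<forall>s\<ge>0. \<bar>bregman f g A \<alpha> \<beta> \<delta> x y u v s\<bar> \<noteq> \<infinity>) \<and>
        (\<lambda>s. real_of_ereal (bregman f g A \<alpha> \<beta> \<delta> x y u v s) / \<beta> s) absolutely_integrable_on {0..t} \<and>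
        integral {0..t} (\<lambda>s. real_of_ereal (bregman f g A \<alpha> \<beta> \<delta> x y u v s) / \<beta> s)
          \<le> energy A \<alpha> \<beta> \<delta> x y u v 0"
      using int(2) by (simp add: eq)
  qed
  have W: "filterlim (\<lambda>t. integral {0..t} (\<lambda>s. 1 / \<beta> s)) at_top at_top"
    if "\<not> (\<lambda>s. 1 / \<beta> s) absolutely_integrable_on {0<..}"
    by (rule integral_tendsto_at_top_of_not_integrable[OF flow.cont_weight _ that]) (simp add: \<beta>_pos)
  have in_S: "p \<in> S" if "\<not> (\<lambda>s. 1 / \<beta> s) absolutely_integrable_on {0<..}"
    "weak_subseq_limit_point (\<lambda>t. (xh t, yh t)) p" for p
    using flow.weak_limit_point_in_solutions[OF W[OF that(1)] S_ne] that(2)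
    by (simp add: S_def xh_def yh_def)
  have conv: "\<exists>p\<in>S. weakly_tendsto (\<lambda>t. (xh t, yh t)) p at_top"
    if nint: "\<not> (\<lambda>s. 1 / \<beta> s) absolutely_integrable_on {0<..}"
      and alt: "((\<lambda>t. \<alpha> t / \<beta> t) constant_on {0..} \<and> (\<lambda>t. \<delta> t / \<beta> t) constant_on {0..}) \<or> is_singleton S"
  proof -
    obtain p where p: "weak_subseq_limit_point (\<lambda>t. (xh t, yh t)) p" using limh by blast
    have "q = p" if q: "weak_subseq_limit_point (\<lambda>t. (xh t, yh t)) q" for q
      using alt
    proof
      assume "is_singleton S"
      then show ?thesis using in_S[OF nint p] in_S[OF nint q] by (auto simp: is_singleton_def)
    next
      assume "(\<lambda>t. \<alpha> t / \<beta> t) constant_on {0..} \<and> (\<lambda>t. \<delta> t / \<beta> t) constant_on {0..}"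
      then obtain a d where "\<And>t. 0 \<le> t \<Longrightarrow> \<alpha> t / \<beta> t = a" "\<And>t. 0 \<le> t \<Longrightarrow> \<delta> t / \<beta> t = d"
        by (auto simp: constant_on_def)
      then show ?thesis
        using flow.ergodic_limit_point_unique[OF W[OF nint], of a d q p] in_S[OF nint p] in_S[OF nint q] p q
        by (simp add: S_def xh_def yh_def)
    qed
    then have "weakly_tendsto (\<lambda>t. (xh t, yh t)) p at_top"
      by (rule bounded_curve_weakly_tendsto[OF bddh])
    then show ?thesis using in_S[OF nint p] by blast
  qed
  have limit_points: "\<not> (\<lambda>s. 1 / \<beta> s) absolutely_integrable_on {0<..} \<longrightarrow>
        (\<forall>p. weak_subseq_limit_point (\<lambda>t. (xh t, yh t)) p \<longrightarrow> p \<in> S)"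
    by (intro impI allI in_S)
  have convergence: "\<not> (\<lambda>s. 1 / \<beta> s) absolutely_integrable_on {0<..} \<and>
      (((\<lambda>t. \<alpha> t / \<beta> t) constant_on {0..} \<and> (\<lambda>t. \<delta> t / \<beta> t) constant_on {0..}) \<or> is_singleton S) \<longrightarrow>
        (\<exists>p\<in>S. weakly_tendsto (\<lambda>t. (xh t, yh t)) p at_top)"
    by (intro impI, elim conjE, rule conv)
  show ?thesis
    by (intro conjI bdd bddh lim limh gap breg limit_points convergence)
qed

end
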